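(* Let $(\Omega,S)$ be a pseudocyclic scheme of valency $k$ with $|S|>2k(k-1)+2$. Then for every $\alpha\in\Omega$ the $\alpha$-extension $(\Omega,S_\alpha)$ is semiregular on $\Omega\setminus\{\alpha\}$.
   Context: A coherent configuration is a pair $(\Omega,S)$ with $\Omega$ finite and $S$ a partition of $\Omega\times\Omega$ such that the diagonal $1_\Omega$ is a union of elements of $S$, $S$ is closed under transposition, and for $r,s,t\in S$ the number $c_{rs}^t=|\{\beta:(\alpha,\beta)\in r,(\beta,\gamma)\in s\}|$ does not depend on $(\alpha,\gamma)\in t$. A scheme is one with $1_\Omega\in S$; $S^\#=S\setminus\{1_\Omega\}$; $\alpha s=\{\beta:(\alpha,\beta)\in s\}$, valency $n_s=|\alpha s|$. With $\mathcal P$ the set of central primitive idempotents of the adjacency algebra $\mathbb{C}S$, $n_P$ the dimension of an irreducible submodule of $\mathbb{C}^\Omega$ corresponding to $P$, $m_P=\operatorname{rk}(P)/n_P$ and $\mathcal P^\#=\mathcal P\setminus\{\frac1{|\Omega|}J\}$, the scheme is pseudocyclic if $m_P/n_P$ is constant on $\mathcal P^\#$; a pseudocyclic scheme has $n_s=k$ for all $s\in S^\#$ for some $k$, its valency. The $\alpha$-extension $(\Omega,S_\alpha)$ is the coarsest coherent configuration on $\Omega$ such that $\{(\alpha,\alpha)\}$ and every $s\in S$ are unions of its basis relations; it is semiregular on $\Omega\setminus\{\alpha\}$ if $|\beta s|\le1$ for all $\beta\ne\alpha$ and all $s\in S_\alpha$ with $s\subseteq(\Omega\setminus\{\alpha\})^2$.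 *)

theory Defs
  imports Complex_Main "HOL-Library.Function_Algebras"
begin

definition coherent_config :: "'a set \<Rightarrow> ('a \<times> 'a) set set \<Rightarrow> bool" where
  "coherent_config \<Omega> S \<longleftrightarrow>
     finite \<Omega> \<and>
     (\<forall>s\<in>S. s \<noteq> {}) \<and> \<Union>S = \<Omega> \<times> \<Omega> \<and>
     (\<forall>s\<in>S. \<forall>t\<in>S. s \<noteq> t \<longrightarrow> s \<inter> t = {}) \<and>
     (\<exists>D\<subseteq>S. \<Union>D = Id_on \<Omega>) \<and>
     (\<forall>s\<in>S. converse s \<in> S) \<and>
     (\<forall>r\<in>S. \<forall>s\<in>S. \<forall>t\<in>S. \<exists>c::nat. \<forall>(a, g)\<in>t.
         card {b. (a, b) \<in> r \<and> (b, g) \<in> s} = c)"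

definition scheme :: "'a set \<Rightarrow> ('a \<times> 'a) set set \<Rightarrow> bool" where
  "scheme \<Omega> S \<longleftrightarrow> coherent_config \<Omega> S \<and> Id_on \<Omega> \<in> S"

definition nbr :: "'a \<Rightarrow> ('a \<times> 'a) set \<Rightarrow> 'a set" where
  "nbr a s = {b. (a, b) \<in> s}"

text \<open>Matrices indexed by Omega x Omega are functions 'a => 'a => complex
 (vanishing outside Omega x Omega); vectors of C^Omega are functions 'a => complex
 vanishing outside Omega.\<close>

definition adj :: "('a \<times> 'a) set \<Rightarrow> 'a \<Rightarrow> 'a \<Rightarrow> complex" where
  "adj s = (\<lambda>x y. if (x, y) \<in> s then 1 else 0)"

definition mmul :: "'a set \<Rightarrow> ('a \<Rightarrow> 'a \<Rightarrow> complex) \<Rightarrow> ('a \<Rightarrow> 'a \<Rightarrow> complex) \<Rightarrow> 'a \<Rightarrow> 'a \<Rightarrow> complex" where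
  "mmul \<Omega> A B = (\<lambda>x z. \<Sum>y\<in>\<Omega>. A x y * B y z)"

definition mvec :: "'a set \<Rightarrow> ('a \<Rightarrow> 'a \<Rightarrow> complex) \<Rightarrow> ('a \<Rightarrow> complex) \<Rightarrow> 'a \<Rightarrow> complex" where
  "mvec \<Omega> A v = (\<lambda>x. if x \<in> \<Omega> then (\<Sum>y\<in>\<Omega>. A x y * v y) else 0)"

definition adj_algebra :: "('a \<times> 'a) set set \<Rightarrow> ('a \<Rightarrow> 'a \<Rightarrow> complex) set" where
  "adj_algebra S = {(\<lambda>x y. \<Sum>s\<in>S. c s * adj s x y) | c. True}"

definition central_idem :: "'a set \<Rightarrow> ('a \<times> 'a) set set \<Rightarrow> ('a \<Rightarrow> 'a \<Rightarrow> complex) \<Rightarrow> bool" where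
  "central_idem \<Omega> S P \<longleftrightarrow> P \<in> adj_algebra S \<and> P \<noteq> 0 \<and> mmul \<Omega> P P = P \<and>
     (\<forall>A\<in>adj_algebra S. mmul \<Omega> P A = mmul \<Omega> A P)"

definition central_prim_idems :: "'a set \<Rightarrow> ('a \<times> 'a) set set \<Rightarrow> ('a \<Rightarrow> 'a \<Rightarrow> complex) set" where
  "central_prim_idems \<Omega> S = {P. central_idem \<Omega> S P \<and>
     \<not> (\<exists>Q R. central_idem \<Omega> S Q \<and> central_idem \<Omega> S R \<and> mmul \<Omega> Q R = 0 \<and> P = Q + R)}"

definition vspace :: "'a set \<Rightarrow> ('a \<Rightarrow> complex) set" where
  "vspace \<Omega> = {v. \<forall>x. x \<notin> \<Omega> \<longrightarrow> v x = 0}"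

definition cscale :: "complex \<Rightarrow> ('a \<Rightarrow> complex) \<Rightarrow> 'a \<Rightarrow> complex" where
  "cscale c v = (\<lambda>x. c * v x)"

definition cdim :: "('a \<Rightarrow> complex) set \<Rightarrow> nat" where
  "cdim V = vector_space.dim cscale V"

definition submodule :: "'a set \<Rightarrow> ('a \<times> 'a) set set \<Rightarrow> ('a \<Rightarrow> complex) set \<Rightarrow> bool" where
  "submodule \<Omega> S W \<longleftrightarrow> W \<subseteq> vspace \<Omega> \<and> module.subspace cscale W \<and>
     (\<forall>A\<in>adj_algebra S. \<forall>w\<in>W. mvec \<Omega> A w \<in> W)"

definition irreducible_submodule :: "'a set \<Rightarrow> ('a \<times> 'a) set set \<Rightarrow> ('a \<Rightarrow> complex) set \<Rightarrow> bool" where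
  "irreducible_submodule \<Omega> S W \<longleftrightarrow> submodule \<Omega> S W \<and> W \<noteq> {0} \<and>
     (\<forall>U. submodule \<Omega> S U \<and> U \<subseteq> W \<longrightarrow> U = {0} \<or> U = W)"

definition rk :: "'a set \<Rightarrow> ('a \<Rightarrow> 'a \<Rightarrow> complex) \<Rightarrow> nat" where
  "rk \<Omega> P = cdim (mvec \<Omega> P ` vspace \<Omega>)"

text \<open>An irreducible submodule corresponds to P iff it lies in the image P C^Omega
 (P acts as the identity on it).\<close>
definition corresponds :: "'a set \<Rightarrow> ('a \<times> 'a) set set \<Rightarrow> ('a \<Rightarrow> 'a \<Rightarrow> complex) \<Rightarrow> ('a \<Rightarrow> complex) set \<Rightarrow> bool" where
  "corresponds \<Omega> S P W \<longleftrightarrow> irreducible_submodule \<Omega> S W \<and> W \<subseteq> mvec \<Omega> P ` vspace \<Omega>"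

text \<open>n_P: the dimension of an irreducible submodule corresponding to P (well defined).\<close>
definition nP :: "'a set \<Rightarrow> ('a \<times> 'a) set set \<Rightarrow> ('a \<Rightarrow> 'a \<Rightarrow> complex) \<Rightarrow> nat" where
  "nP \<Omega> S P = cdim (SOME W. corresponds \<Omega> S P W)"

definition mP :: "'a set \<Rightarrow> ('a \<times> 'a) set set \<Rightarrow> ('a \<Rightarrow> 'a \<Rightarrow> complex) \<Rightarrow> real" where
  "mP \<Omega> S P = real (rk \<Omega> P) / real (nP \<Omega> S P)"

definition Jnorm :: "'a set \<Rightarrow> 'a \<Rightarrow> 'a \<Rightarrow> complex" where
  "Jnorm \<Omega> = (\<lambda>x y. if x \<in> \<Omega> \<and> y \<in> \<Omega> then 1 / of_nat (card \<Omega>) else 0)"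

definition pseudocyclic :: "'a set \<Rightarrow> ('a \<times> 'a) set set \<Rightarrow> bool" where
  "pseudocyclic \<Omega> S \<longleftrightarrow> scheme \<Omega> S \<and>
     (\<exists>c::real. \<forall>P\<in>central_prim_idems \<Omega> S - {Jnorm \<Omega>}. mP \<Omega> S P / real (nP \<Omega> S P) = c)"

definition union_of :: "('a \<times> 'a) set set \<Rightarrow> ('a \<times> 'a) set \<Rightarrow> bool" where
  "union_of T s \<longleftrightarrow> (\<exists>D\<subseteq>T. \<Union>D = s)"

definition alpha_admissible :: "'a set \<Rightarrow> ('a \<times> 'a) set set \<Rightarrow> 'a \<Rightarrow> ('a \<times> 'a) set set \<Rightarrow> bool" where
  "alpha_admissible \<Omega> S a T \<longleftrightarrow> coherent_config \<Omega> T \<and> union_of T {(a, a)} \<and> (\<forall>s\<in>S. union_of T s)"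

definition alpha_ext :: "'a set \<Rightarrow> ('a \<times> 'a) set set \<Rightarrow> 'a \<Rightarrow> ('a \<times> 'a) set set" where
  "alpha_ext \<Omega> S a = (THE T. alpha_admissible \<Omega> S a T \<and>
      (\<forall>T'. alpha_admissible \<Omega> S a T' \<longrightarrow> (\<forall>t\<in>T. union_of T' t)))"

definition semiregular_off :: "'a set \<Rightarrow> ('a \<times> 'a) set set \<Rightarrow> 'a \<Rightarrow> bool" where
  "semiregular_off \<Omega> T a \<longleftrightarrow>
     (\<forall>s\<in>T. s \<subseteq> (\<Omega> - {a}) \<times> (\<Omega> - {a}) \<longrightarrow> (\<forall>b\<in>\<Omega> - {a}. card (nbr b s) \<le> 1))"

end

theory Submission
  imports Defs "HOL-Computational_Algebra.Fundamental_Theorem_Algebra"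
begin

text \<open>
  Let \<open>n = |\<Omega>|\<close> and let \<open>z = \<Sum>s. (1 / n\<^sub>s) A\<^sub>s A\<^sub>s\<^sup>T\<close> be the Casimir element of the adjacency algebra.
  It is central, and Schur's orthogonality relations show that it acts on the range of a central
  primitive idempotent \<open>P\<close> as the scalar \<open>n n\<^sub>P\<^sup>2 / rk P = n n\<^sub>P / m\<^sub>P\<close>. For a pseudocyclic scheme
  \<open>z\<close> is therefore a linear combination of the identity and the all-one matrix, so that its off-diagonal
  entries are constant. As \<open>k z(x, y)\<close> counts the points \<open>b\<close> for which \<open>(x, b)\<close> and \<open>(y, b)\<close> lie in the
  same basis relation, this number is \<open>k - 1\<close> for all \<open>x \<noteq> y\<close>.

  Fix \<open>\<alpha>\<close> and call \<open>\<delta>\<close> bad for \<open>\<beta> \<noteq> \<alpha>\<close> if some other point in the basis relation of \<open>\<beta>\<close> from \<open>\<alpha>\<close> is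
  related to \<open>\<delta>\<close> in the same way as \<open>\<beta>\<close>. At most \<open>(k - 1)\<^sup>2\<close> points are bad for \<open>\<beta>\<close>, so any \<open>\<beta>\<close> and
  \<open>\<gamma>\<close> have a common \<open>\<delta> \<noteq> \<alpha>\<close> that is bad for neither. The basis relations of the \<open>\<alpha>\<close>-extension
  containing \<open>(\<beta>, \<delta>)\<close> and \<open>(\<delta>, \<gamma>)\<close> are then thin, hence so is the one containing \<open>(\<beta>, \<gamma>)\<close>.
\<close>

section \<open>Linear algebra on finitely supported functions\<close>

text \<open>The obstacle: pseudocyclicity speaks of one primitive idempotent at a time, while the
  count needs \<open>z\<close> on all vectors of coordinate sum 0. No decomposition of C^\<Omega>
  into isotypic components is built. Its place is taken by subspaces invariant under the adjacency
  algebra and under averages of matrix units, which commute with the algebra. Orthogonal projection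
  onto such a subspace is a central element of the algebra, so minimal ones yield central primitive
  idempotents. If \<open>z - \<omega>\<close> were nonzero on the sum-zero vectors, its image would
  contain a minimal one, on which \<open>z - \<omega>\<close> vanishes; this contradicts
  \<open>z\<close> being Hermitian. The commutation properties of \<open>z\<close> and of the
  averages rest on one identity for the tensor with terms (1/n_s) A_s \<otimes> A_s^T: a factor from
  the algebra moves from one leg to the other. In terms of intersection numbers this is their
  symmetry once they are weighted by valencies. The bound on |S| enters through |S| \<le>
  |\<Omega>|: at most 2(k-1)^2 + 1 points are excluded as choices of \<delta>.\<close>

interpretation cvec: vector_space cscale
  by unfold_locales (auto simp: cscale_def fun_eq_iff algebra_simps)

lemma sum_fun_apply: "(\<Sum>i\<in>I. f i) x = (\<Sum>i\<in>I. f i x)"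
  by (induction I rule: infinite_finite_induct) auto

lemma subspace_linear_combination:
  assumes "cvec.subspace W" "\<And>i. i \<in> I \<Longrightarrow> f i \<in> W"
  shows "(\<lambda>x. \<Sum>i\<in>I. c i * f i x) \<in> W"
proof -
  have "(\<Sum>i\<in>I. cscale (c i) (f i)) \<in> W"
    using assms by (intro cvec.subspace_sum cvec.subspace_scale) auto
  moreover have "(\<Sum>i\<in>I. cscale (c i) (f i)) = (\<lambda>x. \<Sum>i\<in>I. c i * f i x)"
    by (auto simp: fun_eq_iff sum_fun_apply cscale_def)
  ultimately show ?thesis by simp
qed

section \<open>Hermitian inner product, orthonormal bases and orthogonal projections\<close>

definition ip :: "'a set \<Rightarrow> ('a \<Rightarrow> complex) \<Rightarrow> ('a \<Rightarrow> complex) \<Rightarrow> complex" where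
  "ip \<Omega> v w = (\<Sum>x\<in>\<Omega>. v x * cnj (w x))"

definition orthonormal :: "'a set \<Rightarrow> ('a \<Rightarrow> complex) set \<Rightarrow> bool" where
  "orthonormal \<Omega> B \<longleftrightarrow> (\<forall>e\<in>B. \<forall>f\<in>B. ip \<Omega> e f = (if e = f then 1 else 0))"

text \<open>Spanning is encoded as the Fourier expansion of every vector of \<open>W\<close>, the
  form in which it is used.\<close>

definition onb :: "'a set \<Rightarrow> ('a \<Rightarrow> complex) set \<Rightarrow> ('a \<Rightarrow> complex) set \<Rightarrow> bool" where
  "onb \<Omega> W B \<longleftrightarrow> finite B \<and> B \<subseteq> W \<and> orthonormal \<Omega> B \<and>
     (\<forall>w\<in>W. w = (\<lambda>x. \<Sum>e\<in>B. ip \<Omega> w e * e x))"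

definition mats :: "'a set \<Rightarrow> ('a \<Rightarrow> 'a \<Rightarrow> complex) set" where
  "mats \<Omega> = {A. \<forall>x y. x \<notin> \<Omega> \<or> y \<notin> \<Omega> \<longrightarrow> A x y = 0}"

definition adjm :: "('a \<Rightarrow> 'a \<Rightarrow> complex) \<Rightarrow> 'a \<Rightarrow> 'a \<Rightarrow> complex" where
  "adjm A = (\<lambda>x y. cnj (A y x))"

definition mtrace :: "'a set \<Rightarrow> ('a \<Rightarrow> 'a \<Rightarrow> complex) \<Rightarrow> complex" where
  "mtrace \<Omega> A = (\<Sum>x\<in>\<Omega>. A x x)"

text \<open>For an orthonormal basis \<open>B\<close> of \<open>W\<close>, the matrix of the
  orthogonal projection onto \<open>W\<close>, as a sum of rank-one projections.\<close>

definition onb_proj :: "('a \<Rightarrow> complex) set \<Rightarrow> 'a \<Rightarrow> 'a \<Rightarrow> complex" where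
  "onb_proj B = (\<lambda>x y. \<Sum>e\<in>B. e x * cnj (e y))"

lemma mats_zero: "A \<in> mats \<Omega> \<Longrightarrow> x \<notin> \<Omega> \<or> y \<notin> \<Omega> \<Longrightarrow> A x y = 0"
  by (auto simp: mats_def)

lemma subspace_vspace: "cvec.subspace (vspace \<Omega>)"
  by (auto simp: cvec.subspace_def vspace_def cscale_def)

lemma mvec_in_vspace: "mvec \<Omega> A v \<in> vspace \<Omega>"
  by (simp add: mvec_def vspace_def)

lemma mvec_linear_combination:
  "mvec \<Omega> A (\<lambda>x. \<Sum>i\<in>I. c i * f i x) = (\<lambda>x. \<Sum>i\<in>I. c i * mvec \<Omega> A (f i) x)"
proof
  fix x
  have "(\<Sum>y\<in>\<Omega>. A x y * (\<Sum>i\<in>I. c i * f i y)) = (\<Sum>i\<in>I. c i * (\<Sum>y\<in>\<Omega>. A x y * f i y))"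
    by (simp add: sum_distrib_left mult.left_commute) (rule sum.swap)
  then show "mvec \<Omega> A (\<lambda>x. \<Sum>i\<in>I. c i * f i x) x = (\<Sum>i\<in>I. c i * mvec \<Omega> A (f i) x)"
    by (simp add: mvec_def)
qed

lemma mvec_add: "mvec \<Omega> A (v + w) = mvec \<Omega> A v + mvec \<Omega> A w"
  by (auto simp: mvec_def fun_eq_iff algebra_simps sum.distrib)

lemma mvec_diff: "mvec \<Omega> A (v - w) = mvec \<Omega> A v - mvec \<Omega> A w"
  by (auto simp: mvec_def fun_eq_iff algebra_simps sum_subtractf)

lemma mvec_cscale: "mvec \<Omega> A (cscale c v) = cscale c (mvec \<Omega> A v)"
  by (auto simp: mvec_def cscale_def fun_eq_iff algebra_simps sum_distrib_left)

lemma mvec_zero: "mvec \<Omega> A 0 = 0"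
  by (auto simp: mvec_def fun_eq_iff)

lemma mvec_mmul: "mvec \<Omega> (mmul \<Omega> A B) v = mvec \<Omega> A (mvec \<Omega> B v)"
proof
  fix x
  have "(\<Sum>y\<in>\<Omega>. (\<Sum>z\<in>\<Omega>. A x z * B z y) * v y) = (\<Sum>z\<in>\<Omega>. A x z * (\<Sum>y\<in>\<Omega>. B z y * v y))"
    by (simp add: sum_distrib_left sum_distrib_right mult.assoc) (rule sum.swap)
  then show "mvec \<Omega> (mmul \<Omega> A B) v x = mvec \<Omega> A (mvec \<Omega> B v) x"
    by (auto simp: mvec_def mmul_def intro!: sum.cong)
qed

lemma mmul_in_mats: "A \<in> mats \<Omega> \<Longrightarrow> B \<in> mats \<Omega> \<Longrightarrow> mmul \<Omega> A B \<in> mats \<Omega>"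
  by (auto simp: mats_def mmul_def intro!: sum.neutral)

lemma mtrace_mmul_commute: "mtrace \<Omega> (mmul \<Omega> A B) = mtrace \<Omega> (mmul \<Omega> B A)"
  unfolding mtrace_def mmul_def by (subst sum.swap) (simp add: mult.commute)

lemma ip_diff_left: "ip \<Omega> (u - v) w = ip \<Omega> u w - ip \<Omega> v w"
  by (simp add: ip_def algebra_simps sum_subtractf)

lemma ip_commute: "ip \<Omega> v w = cnj (ip \<Omega> w v)"
  by (simp add: ip_def mult.commute)

lemma ip_sum_left: "ip \<Omega> (\<lambda>x. \<Sum>i\<in>I. c i * f i x) w = (\<Sum>i\<in>I. c i * ip \<Omega> (f i) w)"
  unfolding ip_def
  by (simp add: sum_distrib_left sum_distrib_right mult.assoc) (rule sum.swap)

lemma ip_mvec: "ip \<Omega> (mvec \<Omega> A v) w = ip \<Omega> v (mvec \<Omega> (adjm A) w)"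
proof -
  have "ip \<Omega> (mvec \<Omega> A v) w = (\<Sum>x\<in>\<Omega>. \<Sum>y\<in>\<Omega>. v y * cnj (cnj (A x y) * w x))"
    unfolding ip_def mvec_def by (intro sum.cong) (auto simp: sum_distrib_right sum_distrib_left mult_ac)
  also have "\<dots> = (\<Sum>y\<in>\<Omega>. \<Sum>x\<in>\<Omega>. v y * cnj (cnj (A x y) * w x))"
    by (rule sum.swap)
  also have "\<dots> = ip \<Omega> v (mvec \<Omega> (adjm A) w)"
    unfolding ip_def mvec_def adjm_def by (intro sum.cong) (auto simp: sum_distrib_left)
  finally show ?thesis .
qed

locale fin_index =
  fixes \<Omega> :: "'a set"
  assumes fin: "finite \<Omega>"
begin

lemma ip_self: "ip \<Omega> v v = of_real (\<Sum>x\<in>\<Omega>. (cmod (v x))\<^sup>2)"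
  by (simp add: ip_def complex_norm_square del: of_real_power)

lemma ip_self_eq_0: "v \<in> vspace \<Omega> \<Longrightarrow> ip \<Omega> v v = 0 \<Longrightarrow> v = 0"
proof
  fix x assume v: "v \<in> vspace \<Omega>" "ip \<Omega> v v = 0"
  then have "(\<Sum>x\<in>\<Omega>. (cmod (v x))\<^sup>2) = 0" by (simp add: ip_self del: of_real_sum of_real_power)
  then have "\<forall>x\<in>\<Omega>. v x = 0" using fin by (simp add: sum_nonneg_eq_0_iff)
  then show "v x = 0 x" using v by (auto simp: vspace_def)
qed

lemma mvec_delta: "y \<in> \<Omega> \<Longrightarrow> x \<in> \<Omega> \<Longrightarrow> mvec \<Omega> A (\<lambda>x. if x = y then 1 else 0) x = A x y"
  using fin by (simp add: mvec_def if_distrib cong: if_cong)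

lemma mats_eqI:
  assumes "A \<in> mats \<Omega>" "B \<in> mats \<Omega>" "\<And>v. v \<in> vspace \<Omega> \<Longrightarrow> mvec \<Omega> A v = mvec \<Omega> B v"
  shows "A = B"
proof (intro ext)
  fix x y
  show "A x y = B x y"
  proof (cases "x \<in> \<Omega> \<and> y \<in> \<Omega>")
    case True
    then have "(\<lambda>x. if x = y then 1 else 0) \<in> vspace \<Omega>" by (auto simp: vspace_def)
    from assms(3)[OF this] mvec_delta True show ?thesis by metis
  next
    case False
    then show ?thesis using assms by (auto simp: mats_def)
  qed
qed

lemma vspace_in_span:
  "vspace \<Omega> \<subseteq> cvec.span ((\<lambda>y x. if x = y then 1 else 0) ` \<Omega>)"
proof
  fix v assume v: "v \<in> vspace \<Omega>"
  let ?d = "\<lambda>y x. if x = y then 1 else (0::complex)"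
  have "(\<lambda>x. \<Sum>y\<in>\<Omega>. v y * ?d y x) \<in> cvec.span (?d ` \<Omega>)"
    by (rule subspace_linear_combination) (auto intro: cvec.span_base)
  moreover have "(\<lambda>x. \<Sum>y\<in>\<Omega>. v y * ?d y x) = v"
    using v fin by (auto simp: fun_eq_iff vspace_def if_distrib cong: if_cong)
  ultimately show "v \<in> cvec.span (?d ` \<Omega>)" by simp
qed

lemma independent_vspace:
  assumes "cvec.independent B" "B \<subseteq> vspace \<Omega>"
  shows "finite B" "card B \<le> card \<Omega>"
proof -
  let ?D = "(\<lambda>y x. if x = y then 1 else (0::complex)) ` \<Omega>"
  have "finite B \<and> card B \<le> card ?D"
    using assms vspace_in_span by (intro cvec.independent_span_bound) (auto simp: fin)
  moreover have "card ?D \<le> card \<Omega>" by (rule card_image_le[OF fin])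
  ultimately show "finite B" "card B \<le> card \<Omega>" by auto
qed

lemma orthonormal_independent:
  assumes "orthonormal \<Omega> B"
  shows "cvec.independent B"
  unfolding cvec.independent_explicit_module
proof (intro allI impI, goal_cases)
  case (1 T u v)
  have T: "orthonormal \<Omega> T" using 1(2) assms unfolding orthonormal_def by blast
  have "(\<lambda>x. \<Sum>i\<in>T. u i * i x) = 0"
    using 1(3) by (auto simp: fun_eq_iff sum_fun_apply cscale_def)
  then have "0 = ip \<Omega> (\<lambda>x. \<Sum>i\<in>T. u i * i x) v" by (simp add: ip_def)
  also have "\<dots> = (\<Sum>i\<in>T. u i * (if i = v then 1 else 0))"
    unfolding ip_sum_left using T 1(4) by (intro sum.cong) (auto simp: orthonormal_def)
  also have "\<dots> = u v" using 1 by (simp add: if_distrib cong: if_cong)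
  finally show ?case by simp
qed

lemma ip_proj_residual:
  assumes "finite B" "orthonormal \<Omega> B" "f \<in> B"
  shows "ip \<Omega> (v - (\<lambda>x. \<Sum>e\<in>B. ip \<Omega> v e * e x)) f = 0"
proof -
  have "(\<Sum>e\<in>B. ip \<Omega> v e * ip \<Omega> e f) = (\<Sum>e\<in>B. ip \<Omega> v e * (if e = f then 1 else 0))"
    using assms by (intro sum.cong) (auto simp: orthonormal_def)
  also have "\<dots> = ip \<Omega> v f" using assms by (simp add: if_distrib cong: if_cong)
  finally show ?thesis by (simp add: ip_diff_left ip_sum_left)
qed

text \<open>One Gram-Schmidt step: the residual of \<open>w\<close> is nonzero and orthogonal to
  \<open>B\<close>, and normalising it gives \<open>f\<close>.\<close>

lemma orthonormal_extend:
  assumes W: "cvec.subspace W" "W \<subseteq> vspace \<Omega>" and B: "B \<subseteq> W" "finite B" "orthonormal \<Omega> B"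
    and w: "w \<in> W" "w \<noteq> (\<lambda>x. \<Sum>e\<in>B. ip \<Omega> w e * e x)"
  obtains f where "f \<in> W" "f \<notin> B" "orthonormal \<Omega> (insert f B)"
proof -
  define g where "g = w - (\<lambda>x. \<Sum>e\<in>B. ip \<Omega> w e * e x)"
  have gW: "g \<in> W" unfolding g_def
    using assms by (intro cvec.subspace_diff subspace_linear_combination) auto
  have g0: "g \<noteq> 0" using w(2) by (simp add: g_def)
  have gB: "ip \<Omega> g e = 0" if "e \<in> B" for e
    unfolding g_def using ip_proj_residual[OF B(2,3) that] .
  define r where "r = sqrt (\<Sum>x\<in>\<Omega>. (cmod (g x))\<^sup>2)"
  have gg: "ip \<Omega> g g = of_real (r\<^sup>2)" unfolding r_def
    by (simp add: ip_self sum_nonneg)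
  then have r0: "r \<noteq> 0" using ip_self_eq_0[of g] gW W g0 by auto
  define f where "f = cscale (of_real (1 / r)) g"
  have ff: "ip \<Omega> f f = 1"
  proof -
    have "ip \<Omega> f f = of_real (1 / r)^2 * ip \<Omega> g g"
      by (simp add: ip_def f_def cscale_def sum_distrib_left power2_eq_square algebra_simps)
    then show ?thesis using r0 gg by (simp add: power_divide)
  qed
  have fB: "ip \<Omega> f e = 0" if "e \<in> B" for e
  proof -
    have "ip \<Omega> f e = of_real (1 / r) * ip \<Omega> g e"
      by (simp add: ip_def f_def cscale_def sum_distrib_left algebra_simps)
    then show ?thesis using gB[OF that] by simp
  qed
  have Bf: "ip \<Omega> e f = 0" if "e \<in> B" for e
    using fB[OF that] ip_commute[of \<Omega> e f] by simp
  have "f \<notin> B" using fB ff by force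
  moreover have "f \<in> W" unfolding f_def using gW W by (intro cvec.subspace_scale)
  moreover have "orthonormal \<Omega> (insert f B)"
    using B(3) ff fB Bf \<open>f \<notin> B\<close> by (auto simp: orthonormal_def)
  ultimately show ?thesis using that by blast
qed

text \<open>An orthonormal set of largest cardinality will do. Orthonormal sets are independent,
  hence have at most |\<Omega>| elements, and a vector different from its expansion would allow
  another Gram-Schmidt step.\<close>

lemma onb_exists:
  assumes W: "cvec.subspace W" "W \<subseteq> vspace \<Omega>"
  obtains B where "onb \<Omega> W B"
proof -
  let ?P = "\<lambda>B. B \<subseteq> W \<and> finite B \<and> orthonormal \<Omega> B"
  have bound: "card B \<le> card \<Omega>" if "?P B" for B
    using that W orthonormal_independent independent_vspace(2) by (meson subset_trans)
  have "\<exists>B. ?P B \<and> (\<forall>C. ?P C \<longrightarrow> card C \<le> card B)"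
    by (rule ex_has_greatest_nat[where k = "{}" and b = "Suc (card \<Omega>)"])
       (use bound in \<open>auto simp: orthonormal_def less_Suc_eq_le\<close>)
  then obtain B where B: "B \<subseteq> W" "finite B" "orthonormal \<Omega> B"
    and max: "\<And>C. ?P C \<Longrightarrow> card C \<le> card B" by auto
  have "w = (\<lambda>x. \<Sum>e\<in>B. ip \<Omega> w e * e x)" if "w \<in> W" for w
  proof (rule ccontr)
    assume "w \<noteq> (\<lambda>x. \<Sum>e\<in>B. ip \<Omega> w e * e x)"
    from orthonormal_extend[OF W B that this] obtain f
      where f: "f \<in> W" "f \<notin> B" "orthonormal \<Omega> (insert f B)" .
    have "card (insert f B) \<le> card B" by (rule max) (use f B in auto)
    then show False using f B by simp
  qed
  then have "onb \<Omega> W B" using B by (auto simp: onb_def)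
  then show ?thesis using that by blast
qed

lemma cdim_onb:
  assumes "cvec.subspace W" "onb \<Omega> W B"
  shows "cdim W = card B"
proof -
  have B: "finite B" "B \<subseteq> W" "orthonormal \<Omega> B" using assms by (auto simp: onb_def)
  have "W \<subseteq> cvec.span B"
  proof
    fix w assume "w \<in> W"
    then have "w = (\<lambda>x. \<Sum>e\<in>B. ip \<Omega> w e * e x)" using assms by (auto simp: onb_def)
    moreover have "(\<lambda>x. \<Sum>e\<in>B. ip \<Omega> w e * e x) \<in> cvec.span B"
      by (rule subspace_linear_combination) (auto intro: cvec.span_base)
    ultimately show "w \<in> cvec.span B" by simp
  qed
  then have "cvec.span B = cvec.span W"
    using B(2) cvec.span_superset[of W] by (subst cvec.span_eq) auto
  then show ?thesis unfolding cdim_def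
    by (rule cvec.dim_eq_card) (rule orthonormal_independent[OF B(3)])
qed

lemma cdim_psubset:
  assumes U: "cvec.subspace U" and W: "cvec.subspace W" "W \<subseteq> vspace \<Omega>" and "U \<subset> W"
  shows "cdim U < cdim W"
proof -
  obtain B where B: "onb \<Omega> U B" using onb_exists[OF U] assms by blast
  obtain C where C: "onb \<Omega> W C" using onb_exists[OF W] .
  obtain w where w: "w \<in> W" "w \<notin> U" using assms by blast
  have "(\<lambda>x. \<Sum>e\<in>B. ip \<Omega> w e * e x) \<in> U"
    by (rule subspace_linear_combination[OF U]) (use B in \<open>auto simp: onb_def\<close>)
  then have w_res: "w \<noteq> (\<lambda>x. \<Sum>e\<in>B. ip \<Omega> w e * e x)" using w(2) by metis
  have BW: "B \<subseteq> W" "finite B" "orthonormal \<Omega> B" using B assms(4) by (auto simp: onb_def)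
  obtain f where f: "f \<in> W" "f \<notin> B" "orthonormal \<Omega> (insert f B)"
    using orthonormal_extend[OF W BW w(1) w_res] .
  have "insert f B \<subseteq> cvec.span C"
  proof
    fix v assume "v \<in> insert f B"
    then have "v \<in> W" using f B assms(4) by (auto simp: onb_def)
    then have "v = (\<lambda>x. \<Sum>e\<in>C. ip \<Omega> v e * e x)" using C by (auto simp: onb_def)
    moreover have "(\<lambda>x. \<Sum>e\<in>C. ip \<Omega> v e * e x) \<in> cvec.span C"
      by (rule subspace_linear_combination) (auto intro: cvec.span_base)
    ultimately show "v \<in> cvec.span C" by simp
  qed
  then have "card (insert f B) \<le> card C"
    using cvec.independent_span_bound[of C "insert f B"] orthonormal_independent[OF f(3)] C
    by (auto simp: onb_def)
  then show ?thesis using f B C cdim_onb[OF U B] cdim_onb[OF W(1) C] by (auto simp: onb_def)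
qed

text \<open>A member of least dimension is minimal. The predicate is left abstract because both
  irreducible submodules and minimal bi-invariant subspaces are obtained this way.\<close>

lemma minimal_subspace_exists:
  assumes Q: "Q W" and Q_sub: "\<And>U. Q U \<Longrightarrow> cvec.subspace U \<and> U \<subseteq> vspace \<Omega> \<and> U \<noteq> {0}"
  obtains M where "Q M" "M \<subseteq> W" "\<And>U. Q U \<Longrightarrow> U \<subseteq> M \<Longrightarrow> U = M"
proof -
  obtain M where M: "Q M \<and> M \<subseteq> W" and min: "\<And>U. Q U \<and> U \<subseteq> W \<Longrightarrow> cdim M \<le> cdim U"
    using ex_has_least_nat[of "\<lambda>U. Q U \<and> U \<subseteq> W" W cdim] Q by blast
  have "U = M" if "Q U" "U \<subseteq> M" for U
  proof (rule ccontr)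
    assume "U \<noteq> M"
    then have "cdim U < cdim M" using Q_sub that M by (intro cdim_psubset) auto
    then show False using min[of U] that M by force
  qed
  then show ?thesis using that M by blast
qed

lemma onb_proj_in_mats: "onb \<Omega> W B \<Longrightarrow> W \<subseteq> vspace \<Omega> \<Longrightarrow> onb_proj B \<in> mats \<Omega>"
  by (auto simp: onb_proj_def mats_def onb_def vspace_def intro!: sum.neutral)

lemma mvec_onb_proj:
  assumes "onb \<Omega> W B" "W \<subseteq> vspace \<Omega>"
  shows "mvec \<Omega> (onb_proj B) v = (\<lambda>x. \<Sum>e\<in>B. ip \<Omega> v e * e x)"
proof
  fix x
  have "(\<Sum>y\<in>\<Omega>. (\<Sum>e\<in>B. e x * cnj (e y)) * v y) = (\<Sum>e\<in>B. (\<Sum>y\<in>\<Omega>. v y * cnj (e y)) * e x)"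
    by (simp add: sum_distrib_left sum_distrib_right mult_ac) (rule sum.swap)
  moreover have "(\<Sum>e\<in>B. ip \<Omega> v e * e x) = 0" if "x \<notin> \<Omega>"
    using assms that by (auto simp: onb_def vspace_def intro!: sum.neutral)
  ultimately show "mvec \<Omega> (onb_proj B) v x = (\<Sum>e\<in>B. ip \<Omega> v e * e x)"
    by (simp add: mvec_def onb_proj_def ip_def)
qed

lemma mvec_onb_proj_in:
  assumes "onb \<Omega> W B" "W \<subseteq> vspace \<Omega>" "cvec.subspace W"
  shows "mvec \<Omega> (onb_proj B) v \<in> W"
  unfolding mvec_onb_proj[OF assms(1,2)]
  using assms by (intro subspace_linear_combination) (auto simp: onb_def)

lemma mvec_onb_proj_id:
  assumes "onb \<Omega> W B" "W \<subseteq> vspace \<Omega>" "w \<in> W"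
  shows "mvec \<Omega> (onb_proj B) w = w"
  unfolding mvec_onb_proj[OF assms(1,2)] using assms by (auto simp: onb_def)

lemma mtrace_onb_proj:
  assumes "onb \<Omega> W B"
  shows "mtrace \<Omega> (onb_proj B) = of_nat (card B)"
proof -
  have "mtrace \<Omega> (onb_proj B) = (\<Sum>e\<in>B. ip \<Omega> e e)"
    unfolding mtrace_def onb_proj_def ip_def by (rule sum.swap)
  also have "\<dots> = (\<Sum>e\<in>B. 1)"
    using assms by (intro sum.cong) (auto simp: onb_def orthonormal_def)
  finally show ?thesis by simp
qed

text \<open>Invariance of \<open>W\<close> under the adjoint makes the orthogonal complement
  invariant under \<open>A\<close>, so \<open>A\<close> respects the splitting of \<open>v\<close>
  into its projection and the residual \<open>u\<close>.\<close>

lemma onb_proj_commute: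
  assumes B: "onb \<Omega> W B" "W \<subseteq> vspace \<Omega>" "cvec.subspace W"
    and A: "A \<in> mats \<Omega>" "\<And>w. w \<in> W \<Longrightarrow> mvec \<Omega> A w \<in> W" "\<And>w. w \<in> W \<Longrightarrow> mvec \<Omega> (adjm A) w \<in> W"
  shows "mmul \<Omega> A (onb_proj B) = mmul \<Omega> (onb_proj B) A"
proof (rule mats_eqI)
  let ?E = "onb_proj B"
  note E = onb_proj_in_mats[OF B(1,2)]
  show "mmul \<Omega> A ?E \<in> mats \<Omega>" "mmul \<Omega> ?E A \<in> mats \<Omega>"
    using A(1) E by (auto intro: mmul_in_mats)
  fix v
  define u where "u = v - mvec \<Omega> ?E v"
  have perp: "ip \<Omega> (mvec \<Omega> A u) e = 0" if e: "e \<in> B" for e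
  proof -
    have "mvec \<Omega> (adjm A) e \<in> W" using A(3) B e by (auto simp: onb_def)
    then have ex: "mvec \<Omega> (adjm A) e = (\<lambda>x. \<Sum>f\<in>B. ip \<Omega> (mvec \<Omega> (adjm A) e) f * f x)"
      using B by (auto simp: onb_def)
    have "ip \<Omega> u f = 0" if "f \<in> B" for f
      unfolding u_def mvec_onb_proj[OF B(1,2)]
      using ip_proj_residual that B by (auto simp: onb_def)
    then have "ip \<Omega> f u = 0" if "f \<in> B" for f
      using that ip_commute[of \<Omega> f u] by simp
    then have "ip \<Omega> (mvec \<Omega> (adjm A) e) u = 0"
      by (subst ex) (simp add: ip_sum_left)
    then show ?thesis
      unfolding ip_mvec[of _ A] by (subst ip_commute) simp
  qed
  then have "mvec \<Omega> ?E (mvec \<Omega> A u) = 0"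
    unfolding mvec_onb_proj[OF B(1,2)] by (auto simp: fun_eq_iff)
  moreover have "mvec \<Omega> ?E (mvec \<Omega> A (mvec \<Omega> ?E v)) = mvec \<Omega> A (mvec \<Omega> ?E v)"
    by (intro mvec_onb_proj_id[OF B(1,2)] A(2) mvec_onb_proj_in[OF B])
  moreover have "v = u + mvec \<Omega> ?E v" by (simp add: u_def)
  ultimately have "mvec \<Omega> ?E (mvec \<Omega> A v) = mvec \<Omega> A (mvec \<Omega> ?E v)"
    by (metis mvec_add add.left_neutral)
  then show "mvec \<Omega> (mmul \<Omega> A ?E) v = mvec \<Omega> (mmul \<Omega> ?E A) v"
    by (simp add: mvec_mmul)
qed

section \<open>Eigenvectors on invariant subspaces\<close>

lemma span_image_lessThan:
  "x \<in> cvec.span (v ` {..<m::nat}) \<Longrightarrow> \<exists>c. x = (\<Sum>i<m. cscale (c i) (v i))"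
proof (induction m arbitrary: x)
  case 0
  then show ?case by simp
next
  case (Suc m)
  have "x \<in> cvec.span (insert (v m) (v ` {..<m}))"
    using Suc.prems by (simp add: lessThan_Suc)
  then obtain k where "x - cscale k (v m) \<in> cvec.span (v ` {..<m})"
    by (auto simp: cvec.span_insert)
  then obtain c where c: "x - cscale k (v m) = (\<Sum>i<m. cscale (c i) (v i))"
    using Suc.IH by blast
  have "x = (\<Sum>i<Suc m. cscale ((c(m := k)) i) (v i))"
    using c by (simp add: diff_eq_eq)
  then show ?case by blast
qed

text \<open>A nonzero polynomial \<open>p\<close> of least degree with p(A) w0 = 0 is nonconstant.
  Dividing out a root factor X - l leaves \<open>q\<close> with q(A) w0 nonzero and annihilated by A
  - l.\<close>

lemma eigenvector_exists:
  assumes W: "cvec.subspace W" "W \<subseteq> vspace \<Omega>" "W \<noteq> {0}"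
    and A: "\<And>w. w \<in> W \<Longrightarrow> mvec \<Omega> A w \<in> W"
  obtains w l where "w \<in> W" "w \<noteq> 0" "mvec \<Omega> A w = cscale l w"
proof -
  obtain w0 where w0: "w0 \<in> W" "w0 \<noteq> 0" using W cvec.subspace_0 by blast
  define v where "v i = (mvec \<Omega> A ^^ i) w0" for i :: nat
  have vW: "v i \<in> W" for i by (induction i) (auto simp: v_def w0 A)
  have v_Suc: "mvec \<Omega> A (v i) = v (Suc i)" for i by (simp add: v_def)
  \<comment> \<open>\<open>ev p\<close> is p(A) applied to \<open>w0\<close>.\<close>
  define ev where "ev p = (\<lambda>x. \<Sum>i\<le>degree p. coeff p i * v i x)" for p :: "complex poly"
  have ev_eq: "ev p = (\<lambda>x. \<Sum>i\<le>m. coeff p i * v i x)" if "degree p \<le> m" for p m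
    unfolding ev_def
    by (intro ext sum.mono_neutral_left) (use that in \<open>auto simp: coeff_eq_0\<close>)
  \<comment> \<open>Otherwise every initial segment of iterates would be independent, including one
    of |\<Omega>| + 1 vectors.\<close>
  have "\<exists>m. v m \<in> cvec.span (v ` {..<m})"
  proof (rule ccontr)
    assume a: "\<not> ?thesis"
    have "cvec.independent (v ` {..<m}) \<and> card (v ` {..<m}) = m" for m
    proof (induction m)
      case (Suc m)
      have v1: "v m \<notin> cvec.span (v ` {..<m})" using a by blast
      have v2: "v m \<notin> v ` {..<m}" using v1 cvec.span_base[of "v m" "v ` {..<m}"] by blast
      have "cvec.independent (insert (v m) (v ` {..<m}))"
        using v1 v2 Suc.IH by (subst cvec.independent_insert) simp
      moreover have "card (insert (v m) (v ` {..<m})) = Suc m" using v2 Suc.IH by simp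
      ultimately show ?case by (simp add: lessThan_Suc)
    qed (simp add: cvec.independent_empty)
    then have "Suc (card \<Omega>) \<le> card \<Omega>"
      using independent_vspace(2)[of "v ` {..<Suc (card \<Omega>)}"] vW W(2)
      by (metis (no_types, lifting) image_subset_iff subsetD)
    then show False by simp
  qed
  then obtain m c where c: "v m = (\<Sum>i<m. cscale (c i) (v i))"
    using span_image_lessThan by blast
  \<comment> \<open>The monic polynomial that records the dependence of \<open>v m\<close> on the
    earlier iterates.\<close>
  define p0 where "p0 = monom 1 m - (\<Sum>i<m. monom (c i) i)"
  have cf: "coeff p0 i = (if i = m then 1 else if i < m then - c i else 0)" for i
    by (auto simp: p0_def coeff_sum sum.delta' cong: if_cong)
  have "p0 \<noteq> 0" using cf[of m] by auto
  have "degree p0 \<le> m" by (rule degree_le) (simp add: cf)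
  have "ev p0 = 0"
  proof
    fix x
    have "ev p0 x = (\<Sum>i<m. coeff p0 i * v i x) + coeff p0 m * v m x"
      unfolding ev_eq[OF \<open>degree p0 \<le> m\<close>] by (simp add: lessThan_Suc_atMost[symmetric])
    also have "\<dots> = v m x - (\<Sum>i<m. c i * v i x)" by (simp add: cf sum_negf)
    also have "\<dots> = 0" by (subst c) (simp add: sum_fun_apply cscale_def)
    finally show "ev p0 x = 0 x" by simp
  qed
  obtain p where p: "p \<noteq> 0 \<and> ev p = 0"
    and min: "\<And>q. q \<noteq> 0 \<and> ev q = 0 \<Longrightarrow> degree p \<le> degree q"
    using ex_has_least_nat[of "\<lambda>p. p \<noteq> 0 \<and> ev p = 0" p0 degree] \<open>p0 \<noteq> 0\<close> \<open>ev p0 = 0\<close> by blast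
  have "degree p \<noteq> 0"
  proof
    assume "degree p = 0"
    then have "coeff p 0 * w0 x = 0" for x using p by (auto simp: ev_def v_def fun_eq_iff)
    moreover have "coeff p 0 \<noteq> 0" using p \<open>degree p = 0\<close> leading_coeff_0_iff by metis
    ultimately show False using w0 by (auto simp: fun_eq_iff)
  qed
  then obtain l where "poly p l = 0"
    using fundamental_theorem_of_algebra[of p] constant_degree by metis
  then obtain q where q: "p = [:- l, 1:] * q" by (metis dvdE poly_eq_0_iff_dvd)
  have "q \<noteq> 0" using p q by auto
  have "degree p = Suc (degree q)" unfolding q using \<open>q \<noteq> 0\<close> by (subst degree_mult_eq) auto
  then have "ev q \<noteq> 0" using min[of q] \<open>q \<noteq> 0\<close> by auto
  have "mvec \<Omega> A (ev q) = cscale l (ev q)"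
  proof
    fix x
    let ?m = "degree q"
    \<comment> \<open>Here p = X q - l q, and \<open>pCons 0 q\<close> is X q. Multiplication by X
      shifts the iterates by one, which amounts to one application of \<open>A\<close>.\<close>
    have "ev p x = (\<Sum>i\<le>Suc ?m. coeff (pCons 0 q) i * v i x) - l * (\<Sum>i\<le>Suc ?m. coeff q i * v i x)"
      unfolding ev_eq[of p "Suc ?m", OF eq_refl[OF \<open>degree p = Suc ?m\<close>]]
      by (simp add: q algebra_simps sum_subtractf sum_distrib_left sum.distrib sum_negf)
    also have "(\<Sum>i\<le>Suc ?m. coeff q i * v i x) = ev q x" by (subst ev_eq[of q "Suc ?m"]) auto
    also have "(\<Sum>i\<le>Suc ?m. coeff (pCons 0 q) i * v i x) = (\<Sum>i\<le>?m. coeff q i * v (Suc i) x)"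
      by (subst sum.atMost_Suc_shift) simp
    also have "\<dots> = mvec \<Omega> A (ev q) x"
      unfolding ev_def by (simp add: mvec_linear_combination v_Suc)
    finally show "mvec \<Omega> A (ev q) x = cscale l (ev q) x"
      using p by (simp add: cscale_def)
  qed
  moreover have "ev q \<in> W" unfolding ev_def by (rule subspace_linear_combination) (use W vW in auto)
  ultimately show ?thesis using that \<open>ev q \<noteq> 0\<close> by blast
qed

end

section \<open>Point extensions of coherent configurations\<close>

lemma coherent_configD:
  assumes "coherent_config \<Omega> T"
  shows "finite \<Omega>" "\<And>s. s \<in> T \<Longrightarrow> s \<noteq> {}" "\<Union>T = \<Omega> \<times> \<Omega>"
    "\<And>s t p. s \<in> T \<Longrightarrow> t \<in> T \<Longrightarrow> p \<in> s \<Longrightarrow> p \<in> t \<Longrightarrow> s = t"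
    "union_of T (Id_on \<Omega>)" "\<And>s. s \<in> T \<Longrightarrow> converse s \<in> T"
proof -
  note cc = assms[unfolded coherent_config_def]
  show "finite \<Omega>" using cc by (elim conjE)
  show "\<Union>T = \<Omega> \<times> \<Omega>" using cc by (elim conjE)
  have "\<forall>s\<in>T. s \<noteq> {}" using cc by (elim conjE)
  then show "s \<noteq> {}" if "s \<in> T" for s using that by blast
  have "\<forall>s\<in>T. \<forall>t\<in>T. s \<noteq> t \<longrightarrow> s \<inter> t = {}" using cc by (elim conjE)
  then show "s = t" if "s \<in> T" "t \<in> T" "p \<in> s" "p \<in> t" for s t p using that by blast
  show "union_of T (Id_on \<Omega>)" unfolding union_of_def using cc by (elim conjE)
  have "\<forall>s\<in>T. converse s \<in> T" using cc by (elim conjE)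
  then show "converse s \<in> T" if "s \<in> T" for s using that by blast
qed

lemma coherent_config_count:
  assumes "coherent_config \<Omega> T" "r \<in> T" "s \<in> T" "t \<in> T" "(x, y) \<in> t" "(x', y') \<in> t"
  shows "card {b. (x, b) \<in> r \<and> (b, y) \<in> s} = card {b. (x', b) \<in> r \<and> (b, y') \<in> s}"
proof -
  have "\<forall>r\<in>T. \<forall>s\<in>T. \<forall>t\<in>T. \<exists>c::nat. \<forall>(a, g)\<in>t. card {b. (a, b) \<in> r \<and> (b, g) \<in> s} = c"
    using assms(1) unfolding coherent_config_def by (elim conjE)
  from bspec[OF bspec[OF bspec[OF this assms(2)] assms(3)] assms(4)]
  obtain c where c: "\<forall>(a, g)\<in>t. card {b. (a, b) \<in> r \<and> (b, g) \<in> s} = c" ..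
  show ?thesis using bspec[OF c assms(5)] bspec[OF c assms(6)] by simp
qed

text \<open>An intersection number that is positive at one pair of \<open>t\<close> is positive at
  all of them. In this form coherence enters the semiregularity argument: paths are copied from one
  pair to another.\<close>

lemma coherent_config_path:
  assumes T: "coherent_config \<Omega> T" "r \<in> T" "s \<in> T" "t \<in> T"
    and xy: "(x, y) \<in> t" "(x', y') \<in> t" and z: "(x, z) \<in> r" "(z, y) \<in> s"
  obtains z' where "(x', z') \<in> r" "(z', y') \<in> s"
proof -
  have "{b. (x, b) \<in> r \<and> (b, y) \<in> s} \<subseteq> \<Omega>" using coherent_configD(3)[OF T(1)] T(2) by blast
  then have "finite {b. (x, b) \<in> r \<and> (b, y) \<in> s}"
    using coherent_configD(1)[OF T(1)] finite_subset by blast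
  moreover have "z \<in> {b. (x, b) \<in> r \<and> (b, y) \<in> s}" using z by simp
  ultimately have "card {b. (x, b) \<in> r \<and> (b, y) \<in> s} \<noteq> 0" using card_0_eq by blast
  then have "card {b. (x', b) \<in> r \<and> (b, y') \<in> s} \<noteq> 0"
    using coherent_config_count[OF T xy] by simp
  then have "{b. (x', b) \<in> r \<and> (b, y') \<in> s} \<noteq> {}" by (metis card.empty)
  then show ?thesis using that by blast
qed

text \<open>Being a union becomes saturation under the partition \<open>T\<close>, which can be
  checked pointwise without exhibiting a subfamily.\<close>

lemma union_of_iff:
  assumes "coherent_config \<Omega> T"
  shows "union_of T R \<longleftrightarrow> R \<subseteq> \<Omega> \<times> \<Omega> \<and> (\<forall>t\<in>T. \<forall>p\<in>t. \<forall>q\<in>t. p \<in> R \<longrightarrow> q \<in> R)"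
proof
  assume "union_of T R"
  then obtain D where D: "D \<subseteq> T" "\<Union>D = R" by (auto simp: union_of_def)
  have sub: "R \<subseteq> \<Omega> \<times> \<Omega>" using D coherent_configD(3)[OF assms] by blast
  have closed: "q \<in> R" if "t \<in> T" "p \<in> t" "q \<in> t" "p \<in> R" for t p q
  proof -
    obtain d where "d \<in> D" "p \<in> d" using D(2) \<open>p \<in> R\<close> by blast
    then have "d = t" using coherent_configD(4)[OF assms] D(1) that by blast
    then show ?thesis using \<open>d \<in> D\<close> D(2) that by blast
  qed
  show "R \<subseteq> \<Omega> \<times> \<Omega> \<and> (\<forall>t\<in>T. \<forall>p\<in>t. \<forall>q\<in>t. p \<in> R \<longrightarrow> q \<in> R)"
    by (intro conjI ballI impI sub) (rule closed)
next
  assume R: "R \<subseteq> \<Omega> \<times> \<Omega> \<and> (\<forall>t\<in>T. \<forall>p\<in>t. \<forall>q\<in>t. p \<in> R \<longrightarrow> q \<in> R)"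
  have "\<Union>{t\<in>T. t \<subseteq> R} = R"
  proof
    show "R \<subseteq> \<Union>{t\<in>T. t \<subseteq> R}"
    proof
      fix p assume "p \<in> R"
      then have "p \<in> \<Union>T" using conjunct1[OF R] coherent_configD(3)[OF assms] by blast
      then obtain t where t: "t \<in> T" "p \<in> t" by blast
      have "t \<subseteq> R" using bspec[OF bspec[OF conjunct2[OF R] t(1)] t(2)] \<open>p \<in> R\<close> by blast
      then show "p \<in> \<Union>{t\<in>T. t \<subseteq> R}" using t by blast
    qed
  qed blast
  then show "union_of T R" unfolding union_of_def by (intro exI[of _ "{t\<in>T. t \<subseteq> R}"]) blast
qed

lemma union_of_subset:
  assumes "coherent_config \<Omega> T" "union_of T R" "t \<in> T" "p \<in> t" "p \<in> R"
  shows "t \<subseteq> R"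
proof -
  have "\<forall>t\<in>T. \<forall>p\<in>t. \<forall>q\<in>t. p \<in> R \<longrightarrow> q \<in> R"
    using assms(2) unfolding union_of_iff[OF assms(1)] by (rule conjunct2)
  from bspec[OF bspec[OF this assms(3)] assms(4)] assms(5) show ?thesis by blast
qed

text \<open>Distinct pairs of basis relations contribute disjoint sets of midpoints, so the count is
  a sum of intersection numbers. It serves to prove the coarsest configuration coherent.\<close>

lemma union_of_count:
  assumes T: "coherent_config \<Omega> T" and rs: "union_of T r" "union_of T s"
    and t: "t \<in> T" "(x, y) \<in> t" "(x', y') \<in> t"
  shows "card {b. (x, b) \<in> r \<and> (b, y) \<in> s} = card {b. (x', b) \<in> r \<and> (b, y') \<in> s}"
proof -
  obtain D1 D2 where D: "D1 \<subseteq> T" "\<Union>D1 = r" "D2 \<subseteq> T" "\<Union>D2 = s" using rs by (auto simp: union_of_def)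
  have fin: "finite \<Omega>" by (rule coherent_configD(1)[OF T])
  have "finite T" by (rule finite_UnionD) (simp add: coherent_configD(3)[OF T] fin)
  then have finD: "finite (D1 \<times> D2)" using D by (meson finite_SigmaI finite_subset)
  have expand: "card {b. (x, b) \<in> r \<and> (b, y) \<in> s} =
    (\<Sum>p\<in>D1 \<times> D2. card {b. (x, b) \<in> fst p \<and> (b, y) \<in> snd p})" for x y
  proof -
    have "{b. (x, b) \<in> r \<and> (b, y) \<in> s} = (\<Union>p\<in>D1 \<times> D2. {b. (x, b) \<in> fst p \<and> (b, y) \<in> snd p})"
      unfolding D(2)[symmetric] D(4)[symmetric] by auto
    also have "card \<dots> = (\<Sum>p\<in>D1 \<times> D2. card {b. (x, b) \<in> fst p \<and> (b, y) \<in> snd p})"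
    proof (rule card_UN_disjoint[OF finD])
      show "\<forall>p\<in>D1 \<times> D2. finite {b. (x, b) \<in> fst p \<and> (b, y) \<in> snd p}"
      proof
        fix p assume "p \<in> D1 \<times> D2"
        then have "{b. (x, b) \<in> fst p \<and> (b, y) \<in> snd p} \<subseteq> \<Omega>"
          using D(1) coherent_configD(3)[OF T] by (auto simp: mem_Times_iff)
        then show "finite {b. (x, b) \<in> fst p \<and> (b, y) \<in> snd p}" using fin finite_subset by blast
      qed
      show "\<forall>p\<in>D1 \<times> D2. \<forall>q\<in>D1 \<times> D2. p \<noteq> q \<longrightarrow>
        {b. (x, b) \<in> fst p \<and> (b, y) \<in> snd p} \<inter> {b. (x, b) \<in> fst q \<and> (b, y) \<in> snd q} = {}"
      proof (intro ballI impI, rule ccontr)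
        fix p q assume pq: "p \<in> D1 \<times> D2" "q \<in> D1 \<times> D2" "p \<noteq> q"
          and "{b. (x, b) \<in> fst p \<and> (b, y) \<in> snd p} \<inter> {b. (x, b) \<in> fst q \<and> (b, y) \<in> snd q} \<noteq> {}"
        then obtain b where b: "(x, b) \<in> fst p" "(b, y) \<in> snd p" "(x, b) \<in> fst q" "(b, y) \<in> snd q" by blast
        have "fst p \<in> T" "fst q \<in> T" "snd p \<in> T" "snd q \<in> T" using pq D by auto
        then have "fst p = fst q" "snd p = snd q" using coherent_configD(4)[OF T] b by blast+
        then show False using pq(3) by (simp add: prod_eq_iff)
      qed
    qed
    finally show ?thesis .
  qed
  show ?thesis unfolding expand
  proof (rule sum.cong[OF refl])
    fix p assume "p \<in> D1 \<times> D2"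
    then have "fst p \<in> T" "snd p \<in> T" using D by auto
    then show "card {b. (x, b) \<in> fst p \<and> (b, y) \<in> snd p} = card {b. (x', b) \<in> fst p \<and> (b, y') \<in> snd p}"
      using coherent_config_count[OF T] t by blast
  qed
qed

text \<open>Applied in both directions, this gives the uniqueness demanded by the \<open>THE\<close>
  in \<open>alpha_ext\<close>.\<close>

lemma coherent_config_mutual_union:
  assumes T: "coherent_config \<Omega> T" "coherent_config \<Omega> T'"
    and u: "\<forall>t\<in>T. union_of T' t" "\<forall>t\<in>T'. union_of T t"
  shows "T \<subseteq> T'"
proof
  fix t assume t: "t \<in> T"
  then obtain p where p: "p \<in> t" using coherent_configD(2)[OF T(1)] by blast
  then have "p \<in> \<Omega> \<times> \<Omega>" using t coherent_configD(3)[OF T(1)] by blast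
  then obtain t' where t': "t' \<in> T'" "p \<in> t'" using coherent_configD(3)[OF T(2)] by blast
  have "union_of T' t" "union_of T t'" using u t t' by auto
  then have "t' \<subseteq> t" "t \<subseteq> t'"
    using union_of_subset[OF T(2) _ t'(1,2) p] union_of_subset[OF T(1) _ t p t'(2)] by simp_all
  then show "t \<in> T'" using t' by auto
qed

text \<open>The coarsest admissible configuration consists of the atoms of the Boolean algebra of all
  relations that are unions of basis relations in every admissible configuration.\<close>

lemma alpha_ext_admissible:
  assumes S: "coherent_config \<Omega> S" and a: "a \<in> \<Omega>"
  shows "alpha_admissible \<Omega> S a (alpha_ext \<Omega> S a)"
proof -
  \<comment> \<open>Were there no admissible configuration, every relation would lie in
    \<open>\<B>\<close> vacuously. The argument therefore settles existence together with
    minimality.\<close>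
  define \<B> where "\<B> = {R. R \<subseteq> \<Omega> \<times> \<Omega> \<and> (\<forall>T. alpha_admissible \<Omega> S a T \<longrightarrow> union_of T R)}"
  define cl where "cl p = {q \<in> \<Omega> \<times> \<Omega>. \<forall>R\<in>\<B>. p \<in> R \<longleftrightarrow> q \<in> R}" for p
  define M where "M = cl ` (\<Omega> \<times> \<Omega>)"
  have adm: "coherent_config \<Omega> T" "union_of T {(a, a)}" "\<And>s. s \<in> S \<Longrightarrow> union_of T s"
    if "alpha_admissible \<Omega> S a T" for T using that by (auto simp: alpha_admissible_def)
  have BI: "R \<in> \<B>" if sub: "R \<subseteq> \<Omega> \<times> \<Omega>"
    and closed: "\<And>T t p q. alpha_admissible \<Omega> S a T \<Longrightarrow> t \<in> T \<Longrightarrow> p \<in> t \<Longrightarrow> q \<in> t \<Longrightarrow> p \<in> R \<Longrightarrow> q \<in> R" for R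
  proof -
    have "union_of T R" if T: "alpha_admissible \<Omega> S a T" for T
      unfolding union_of_iff[OF adm(1)[OF T]] 
      by (intro conjI ballI impI sub) (rule closed[OF T])
    then show ?thesis unfolding \<B>_def using sub by blast
  qed
  have BD: "q \<in> R" if "R \<in> \<B>" "alpha_admissible \<Omega> S a T" "t \<in> T" "p \<in> t" "q \<in> t" "p \<in> R" for R T t p q
  proof -
    have "union_of T R" using that(1,2) unfolding \<B>_def by blast
    then show ?thesis using union_of_subset[OF adm(1)[OF that(2)] _ that(3,4,6)] that(5) by blast
  qed
  have Bsub: "R \<subseteq> \<Omega> \<times> \<Omega>" if "R \<in> \<B>" for R using that by (simp add: \<B>_def)
  have t_sub: "t \<subseteq> \<Omega> \<times> \<Omega>" if "alpha_admissible \<Omega> S a T" "t \<in> T" for T t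
    using coherent_configD(3)[OF adm(1)[OF that(1)]] that(2) by blast
  have self: "p \<in> cl p" if "p \<in> \<Omega> \<times> \<Omega>" for p using that by (simp add: cl_def)
  have cl_eq: "cl p = cl q" if "q \<in> cl p" for p q using that unfolding cl_def by blast
  have cl_sub: "cl p \<subseteq> R" if "R \<in> \<B>" "p \<in> R" for p R using that unfolding cl_def by blast
  have clB: "cl p \<in> \<B>" for p
  proof (rule BI)
    fix T t q q' assume T: "alpha_admissible \<Omega> S a T" "t \<in> T" "q \<in> t" "q' \<in> t" "q \<in> cl p"
    have "q \<in> R \<longleftrightarrow> q' \<in> R" if "R \<in> \<B>" for R
      using BD[OF that T(1,2,3,4)] BD[OF that T(1,2,4,3)] by blast
    then show "q' \<in> cl p" using T(5) t_sub[OF T(1,2)] T(4) unfolding cl_def by blast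
  qed (auto simp: cl_def)
  have MB: "M \<subseteq> \<B>" using clB by (auto simp: M_def)
  have B_union: "union_of M R" if R: "R \<in> \<B>" for R
  proof -
    have "\<Union>(cl ` R) = R"
    proof
      show "\<Union>(cl ` R) \<subseteq> R" using R unfolding cl_def by blast
      show "R \<subseteq> \<Union>(cl ` R)" using self Bsub[OF R] by blast
    qed
    then show ?thesis unfolding union_of_def M_def using Bsub[OF R] by (intro exI[of _ "cl ` R"]) blast
  qed
  have convB: "converse R \<in> \<B>" if R: "R \<in> \<B>" for R
  proof (rule BI)
    show "converse R \<subseteq> \<Omega> \<times> \<Omega>" using Bsub[OF R] by blast
    fix T t p q assume T: "alpha_admissible \<Omega> S a T" "t \<in> T" "p \<in> t" "q \<in> t" "p \<in> converse R"
    obtain p1 p2 q1 q2 where pq: "p = (p1, p2)" "q = (q1, q2)" by fastforce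
    have "converse t \<in> T" by (rule coherent_configD(6)[OF adm(1)[OF T(1)] T(2)])
    then have "(q2, q1) \<in> R" by (rule BD[OF R T(1), of _ "(p2, p1)"]) (use T pq in auto)
    then show "q \<in> converse R" using pq by simp
  qed
  have IdB: "Id_on \<Omega> \<in> \<B>"
    unfolding \<B>_def using coherent_configD(5) adm(1) by blast
  \<comment> \<open>An atom meeting a level set of a path count is contained in it once the level
    set lies in \<open>\<B>\<close>; this makes the counts constant on atoms.\<close>
  have countB: "{p \<in> \<Omega> \<times> \<Omega>. card {b. (fst p, b) \<in> r \<and> (b, snd p) \<in> s} = c} \<in> \<B>"
    if rs: "r \<in> \<B>" "s \<in> \<B>" for r s c
  proof (rule BI)
    fix T t p q assume T: "alpha_admissible \<Omega> S a T" "t \<in> T" "p \<in> t" "q \<in> t"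
      and p: "p \<in> {p \<in> \<Omega> \<times> \<Omega>. card {b. (fst p, b) \<in> r \<and> (b, snd p) \<in> s} = c}"
    have u: "union_of T r" "union_of T s" using rs T(1) unfolding \<B>_def by blast+
    have "card {b. (fst p, b) \<in> r \<and> (b, snd p) \<in> s} = card {b. (fst q, b) \<in> r \<and> (b, snd q) \<in> s}"
      by (rule union_of_count[OF adm(1)[OF T(1)] u T(2)]) (use T in auto)
    then show "q \<in> {p \<in> \<Omega> \<times> \<Omega>. card {b. (fst p, b) \<in> r \<and> (b, snd p) \<in> s} = c}"
      using p t_sub[OF T(1,2)] T(4) by auto
  qed auto
  have M_cc: "coherent_config \<Omega> M"
    unfolding coherent_config_def
  proof (intro conjI)
    show "finite \<Omega>" by (rule coherent_configD(1)[OF S])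
    show "\<forall>s\<in>M. s \<noteq> {}" using self by (auto simp: M_def)
    show "\<Union>M = \<Omega> \<times> \<Omega>"
    proof
      show "\<Union>M \<subseteq> \<Omega> \<times> \<Omega>" unfolding M_def cl_def by blast
      show "\<Omega> \<times> \<Omega> \<subseteq> \<Union>M" using self unfolding M_def by blast
    qed
    show "\<forall>s\<in>M. \<forall>t\<in>M. s \<noteq> t \<longrightarrow> s \<inter> t = {}"
    proof (intro ballI impI, rule ccontr)
      fix s t assume st: "s \<in> M" "t \<in> M" "s \<noteq> t" "s \<inter> t \<noteq> {}"
      then obtain q where q: "q \<in> s" "q \<in> t" by blast
      obtain p p' where "s = cl p" "t = cl p'" using st by (auto simp: M_def)
      then have "s = cl q" "t = cl q" using cl_eq[of q p] cl_eq[of q p'] q by simp_all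
      then show False using st by simp
    qed
    show "\<exists>D\<subseteq>M. \<Union>D = Id_on \<Omega>" using B_union[OF IdB] by (simp add: union_of_def)
    show "\<forall>s\<in>M. converse s \<in> M"
    proof
      fix s assume "s \<in> M"
      then obtain x y where xy: "x \<in> \<Omega>" "y \<in> \<Omega>" "s = cl (x, y)" by (auto simp: M_def)
      have "converse (cl (x, y)) = cl (y, x)" if "x \<in> \<Omega>" "y \<in> \<Omega>" for x y
      proof (rule set_eqI)
        fix q :: "'a \<times> 'a"
        obtain u v where q: "q = (u, v)" by fastforce
        have "(\<forall>R\<in>\<B>. (x, y) \<in> R \<longleftrightarrow> (v, u) \<in> R) \<longleftrightarrow> (\<forall>R\<in>\<B>. (y, x) \<in> R \<longleftrightarrow> (u, v) \<in> R)"
        proof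
          assume *: "\<forall>R\<in>\<B>. (x, y) \<in> R \<longleftrightarrow> (v, u) \<in> R"
          show "\<forall>R\<in>\<B>. (y, x) \<in> R \<longleftrightarrow> (u, v) \<in> R"
            using bspec[OF * convB] by simp
        next
          assume *: "\<forall>R\<in>\<B>. (y, x) \<in> R \<longleftrightarrow> (u, v) \<in> R"
          show "\<forall>R\<in>\<B>. (x, y) \<in> R \<longleftrightarrow> (v, u) \<in> R"
            using bspec[OF * convB] by simp
        qed
        then show "q \<in> converse (cl (x, y)) \<longleftrightarrow> q \<in> cl (y, x)" unfolding q cl_def by auto
      qed
      then show "converse s \<in> M" using xy unfolding M_def by auto
    qed
    show "\<forall>r\<in>M. \<forall>s\<in>M. \<forall>t\<in>M. \<exists>c. \<forall>(x, y)\<in>t. card {b. (x, b) \<in> r \<and> (b, y) \<in> s} = c"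
    proof (intro ballI)
      fix r s t assume rst: "r \<in> M" "s \<in> M" "t \<in> M"
      obtain p where p: "p \<in> \<Omega> \<times> \<Omega>" "t = cl p" using rst by (auto simp: M_def)
      let ?n = "\<lambda>q. card {b. (fst q, b) \<in> r \<and> (b, snd q) \<in> s}"
      have "{q \<in> \<Omega> \<times> \<Omega>. ?n q = ?n p} \<in> \<B>" by (rule countB) (use MB rst in auto)
      then have "t \<subseteq> {q \<in> \<Omega> \<times> \<Omega>. ?n q = ?n p}"
        unfolding p(2) by (rule cl_sub) (use p in simp)
      then have "?n q = ?n p" if "q \<in> t" for q using that by blast
      from this[of "(_, _)"] have "\<forall>(x, y)\<in>t. card {b. (x, b) \<in> r \<and> (b, y) \<in> s} = ?n p" by auto
      then show "\<exists>c. \<forall>(x, y)\<in>t. card {b. (x, b) \<in> r \<and> (b, y) \<in> s} = c" by (rule exI)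
    qed
  qed
  have aB: "{(a, a)} \<in> \<B>" unfolding \<B>_def using a adm(2) by simp
  have SB: "s \<in> \<B>" if "s \<in> S" for s
  proof -
    have "s \<subseteq> \<Omega> \<times> \<Omega>" using coherent_configD(3)[OF S] that by blast
    then show ?thesis unfolding \<B>_def using adm(3) that by simp
  qed
  let ?Q = "\<lambda>T. alpha_admissible \<Omega> S a T \<and>
      (\<forall>T'. alpha_admissible \<Omega> S a T' \<longrightarrow> (\<forall>t\<in>T. union_of T' t))"
  have QM: "?Q M"
  proof (intro conjI allI impI ballI)
    show "alpha_admissible \<Omega> S a M"
      unfolding alpha_admissible_def using M_cc B_union[OF aB] B_union[OF SB] by blast
    show "union_of T' t" if "alpha_admissible \<Omega> S a T'" "t \<in> M" for T' t
      using that MB unfolding \<B>_def by blast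
  qed
  have uniq: "T = M" if QT: "?Q T" for T
  proof (rule subset_antisym)
    have T: "alpha_admissible \<Omega> S a T" "\<forall>t\<in>T. union_of M t" using QT QM by simp_all
    have M': "\<forall>t\<in>M. union_of T t" using QM T(1) by simp
    show "T \<subseteq> M" by (rule coherent_config_mutual_union[OF adm(1)[OF T(1)] M_cc T(2) M'])
    show "M \<subseteq> T" by (rule coherent_config_mutual_union[OF M_cc adm(1)[OF T(1)] M' T(2)])
  qed
  have "alpha_ext \<Omega> S a = M"
    unfolding alpha_ext_def by (rule the_equality[where P = ?Q, OF QM uniq])
  then show ?thesis using QM by simp
qed

section \<open>The Casimir element of the adjacency algebra\<close>

definition transp :: "('a \<Rightarrow> 'a \<Rightarrow> complex) \<Rightarrow> 'a \<Rightarrow> 'a \<Rightarrow> complex" where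
  "transp A = (\<lambda>x y. A y x)"

lemma transp_transp: "transp (transp A) = A"
  by (simp add: transp_def)

lemma transp_mmul: "transp (mmul \<Omega> A B) = mmul \<Omega> (transp B) (transp A)"
  by (simp add: transp_def mmul_def mult.commute)

section \<open>Schemes with one common valency, read as colourings of pairs of points\<close>

locale equivalenced_scheme =
  fixes \<Omega> :: "'a set" and S :: "('a \<times> 'a) set set" and k :: nat
  assumes sch: "scheme \<Omega> S"
    and valency: "\<forall>s\<in>S - {Id_on \<Omega>}. \<forall>a\<in>\<Omega>. card (nbr a s) = k"
    and k_pos: "k > 0"
    and nonempty: "\<Omega> \<noteq> {}"
begin

sublocale fin_index \<Omega>
  by unfold_locales (use sch in \<open>auto simp: scheme_def coherent_config_def\<close>)

text \<open>Meaningful on \<Omega> \<times> \<Omega> alone, where exactly one basis relation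
  contains the pair.\<close>

definition colour :: "'a \<Rightarrow> 'a \<Rightarrow> ('a \<times> 'a) set" where
  "colour x y = (THE s. s \<in> S \<and> (x, y) \<in> s)"

text \<open>The valency of the basis relation through the pair, given in terms of its
  points.\<close>

definition val :: "'a \<Rightarrow> 'a \<Rightarrow> nat" where
  "val x y = (if x = y then 1 else k)"

abbreviation "CS \<equiv> adj_algebra S"

lemma
  shows S_union: "\<Union>S = \<Omega> \<times> \<Omega>"
    and S_disjoint: "s \<in> S \<Longrightarrow> t \<in> S \<Longrightarrow> p \<in> s \<Longrightarrow> p \<in> t \<Longrightarrow> s = t"
    and S_converse: "s \<in> S \<Longrightarrow> converse s \<in> S"
    and S_nonempty: "s \<in> S \<Longrightarrow> s \<noteq> {}"
    and S_Id: "Id_on \<Omega> \<in> S"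
  using sch coherent_configD[of \<Omega> S] unfolding scheme_def by simp_all

lemma S_coherent:
  assumes "r \<in> S" "s \<in> S" "t \<in> S" "(x, y) \<in> t" "(u, v) \<in> t"
  shows "card {b. (x, b) \<in> r \<and> (b, y) \<in> s} = card {b. (u, b) \<in> r \<and> (b, v) \<in> s}"
  using sch coherent_config_count[OF _ assms] unfolding scheme_def by blast

lemma finite_S: "finite S"
  by (rule finite_UnionD) (simp add: S_union fin)

lemma colour_eqI: "s \<in> S \<Longrightarrow> (x, y) \<in> s \<Longrightarrow> colour x y = s"
  unfolding colour_def using S_disjoint by (intro the_equality) auto

lemma colour_in:
  assumes "x \<in> \<Omega>" "y \<in> \<Omega>"
  shows "colour x y \<in> S" "(x, y) \<in> colour x y"
proof -
  obtain s where "s \<in> S" "(x, y) \<in> s" using assms S_union by blast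
  then show "colour x y \<in> S" "(x, y) \<in> colour x y" using colour_eqI by auto
qed

lemma mem_iff_colour: "s \<in> S \<Longrightarrow> (x, y) \<in> s \<longleftrightarrow> x \<in> \<Omega> \<and> y \<in> \<Omega> \<and> colour x y = s"
  using colour_eqI colour_in S_union by blast

lemma colour_converse: "x \<in> \<Omega> \<Longrightarrow> y \<in> \<Omega> \<Longrightarrow> colour y x = converse (colour x y)"
  using colour_in S_converse by (intro colour_eqI) auto

lemma colour_swap_eq:
  "x \<in> \<Omega> \<Longrightarrow> y \<in> \<Omega> \<Longrightarrow> u \<in> \<Omega> \<Longrightarrow> v \<in> \<Omega> \<Longrightarrow> colour y x = colour v u \<longleftrightarrow> colour x y = colour u v"
  by (metis colour_converse)

lemma colour_converse_iff: "x \<in> \<Omega> \<Longrightarrow> y \<in> \<Omega> \<Longrightarrow> colour x y = t \<longleftrightarrow> colour y x = converse t"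
  using colour_converse[of x y] by auto

lemma colour_diag: "x \<in> \<Omega> \<Longrightarrow> colour x x = Id_on \<Omega>"
  using S_Id by (intro colour_eqI) auto

lemma colour_diag_iff: "x \<in> \<Omega> \<Longrightarrow> y \<in> \<Omega> \<Longrightarrow> colour x y = Id_on \<Omega> \<longleftrightarrow> x = y"
  using colour_diag colour_in(2)[of x y] by auto

lemma val_cong:
  "x \<in> \<Omega> \<Longrightarrow> y \<in> \<Omega> \<Longrightarrow> u \<in> \<Omega> \<Longrightarrow> v \<in> \<Omega> \<Longrightarrow> colour x y = colour u v \<Longrightarrow> val x y = val u v"
  using colour_diag_iff by (metis val_def)

lemma val_pos: "val x y > 0"
  using k_pos by (simp add: val_def)

lemma card_row:
  assumes "x \<in> \<Omega>" "u \<in> \<Omega>" "v \<in> \<Omega>"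
  shows "card {y\<in>\<Omega>. colour x y = colour u v} = val u v"
proof -
  have eq: "{y\<in>\<Omega>. colour x y = colour u v} = nbr x (colour u v)"
    using assms colour_in[of u v] mem_iff_colour[of "colour u v"] by (auto simp: nbr_def)
  show ?thesis
  proof (cases "u = v")
    case True
    then have "nbr x (colour u v) = {x}" using assms by (auto simp: colour_diag nbr_def)
    then show ?thesis using True eq by (simp add: val_def)
  next
    case False
    then have "colour u v \<in> S - {Id_on \<Omega>}" using assms colour_in colour_diag_iff by auto
    then show ?thesis using False eq valency assms by (simp add: val_def)
  qed
qed

lemma card_col:
  assumes "y \<in> \<Omega>" "u \<in> \<Omega>" "v \<in> \<Omega>"
  shows "card {x\<in>\<Omega>. colour x y = colour u v} = val u v"
proof -
  have "{x\<in>\<Omega>. colour x y = colour u v} = {x\<in>\<Omega>. colour y x = colour v u}"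
    using assms colour_swap_eq by blast
  then show ?thesis using card_row[of y v u] assms by (auto simp: val_def)
qed

lemma card_triangles_cong:
  assumes "x \<in> \<Omega>" "y \<in> \<Omega>" "u \<in> \<Omega>" "v \<in> \<Omega>" "colour x y = colour u v"
  shows "card {z\<in>\<Omega>. colour x z = r \<and> colour z y = s} = card {z\<in>\<Omega>. colour u z = r \<and> colour z v = s}"
proof (cases "r \<in> S \<and> s \<in> S")
  case True
  let ?t = "colour x y"
  have t: "?t \<in> S" "(x, y) \<in> ?t" "(u, v) \<in> ?t"
    using colour_in[of x y] colour_in[of u v] assms by auto
  have rs: "r \<in> S" "s \<in> S" using True by auto
  have "card {b. (x, b) \<in> r \<and> (b, y) \<in> s} = card {b. (u, b) \<in> r \<and> (b, v) \<in> s}"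
    by (rule S_coherent[OF rs t])
  moreover have "{b. (x, b) \<in> r \<and> (b, y) \<in> s} = {z\<in>\<Omega>. colour x z = r \<and> colour z y = s}"
    "{b. (u, b) \<in> r \<and> (b, v) \<in> s} = {z\<in>\<Omega>. colour u z = r \<and> colour z v = s}"
    using True mem_iff_colour assms by auto
  ultimately show ?thesis by simp
next
  case False
  then have "{z\<in>\<Omega>. colour x z = r \<and> colour z y = s} = {}" "{z\<in>\<Omega>. colour u z = r \<and> colour z v = s} = {}"
    using colour_in assms by auto
  then show ?thesis by (simp only: card.empty)
qed

text \<open>Both sides count the paths of the prescribed colours that end in the fixed point \<open>y\<close>.\<close>

lemma triangle_count:
  assumes "x \<in> \<Omega>" "y \<in> \<Omega>" "u \<in> \<Omega>" "v \<in> \<Omega>"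
  shows "val x y * card {m\<in>\<Omega>. colour x m = t \<and> colour m y = colour u v} =
         val u v * card {p\<in>\<Omega>. colour p v = colour x y \<and> colour p u = t}"
proof -
  \<comment> \<open>Fixing \<open>p\<close> leaves \<open>val x y\<close> nonzero sums, each equal
    to the count over (x, y); fixing \<open>m\<close> leaves \<open>val u v\<close> nonzero sums,
    each equal to the count over (u, v).\<close>
  let ?f = "\<lambda>p m. if colour p y = colour x y \<and> colour p m = t \<and> colour m y = colour u v then 1 else 0 :: nat"
  let ?C1 = "card {m\<in>\<Omega>. colour x m = t \<and> colour m y = colour u v}"
  let ?C2 = "card {p\<in>\<Omega>. colour p v = colour x y \<and> colour p u = t}"
  have card_sum: "(\<Sum>m\<in>\<Omega>. if Q m then 1 else 0 :: nat) = card {m\<in>\<Omega>. Q m}" for Q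
    using fin by (simp add: sum.If_cases Int_def)
  have 1: "(\<Sum>m\<in>\<Omega>. ?f p m) = (if colour p y = colour x y then 1 else 0) * ?C1" if p: "p \<in> \<Omega>" for p
    unfolding card_sum using card_triangles_cong[of p y x y t "colour u v"] p assms by auto
  have 2: "(\<Sum>p\<in>\<Omega>. ?f p m) = (if colour m y = colour u v then 1 else 0) * ?C2" if m: "m \<in> \<Omega>" for m
  proof (cases "colour m y = colour u v")
    case True
    have flip: "{p\<in>\<Omega>. colour p b = colour x y \<and> colour p a = t} =
        {p\<in>\<Omega>. colour a p = converse t \<and> colour p b = colour x y}" if "a \<in> \<Omega>" for a b
      using that colour_converse_iff[of _ a t] by blast
    have "(\<Sum>p\<in>\<Omega>. ?f p m) = card {p\<in>\<Omega>. colour p y = colour x y \<and> colour p m = t}"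
      unfolding card_sum using True by simp
    also have "\<dots> = ?C2"
      unfolding flip[OF m] flip[OF assms(3)] using card_triangles_cong m assms True by blast
    finally show ?thesis using True by simp
  qed simp
  have "(\<Sum>p\<in>\<Omega>. \<Sum>m\<in>\<Omega>. ?f p m) = (\<Sum>p\<in>\<Omega>. (if colour p y = colour x y then 1 else 0) * ?C1)"
    by (rule sum.cong[OF refl 1])
  also have "\<dots> = val x y * ?C1"
    unfolding sum_distrib_right[symmetric] card_sum using card_col assms by simp
  finally have L: "(\<Sum>p\<in>\<Omega>. \<Sum>m\<in>\<Omega>. ?f p m) = val x y * ?C1" .
  have "(\<Sum>m\<in>\<Omega>. \<Sum>p\<in>\<Omega>. ?f p m) = (\<Sum>m\<in>\<Omega>. (if colour m y = colour u v then 1 else 0) * ?C2)"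
    by (rule sum.cong[OF refl 2])
  also have "\<dots> = val u v * ?C2"
    unfolding sum_distrib_right[symmetric] card_sum using card_col assms by simp
  finally have "(\<Sum>m\<in>\<Omega>. \<Sum>p\<in>\<Omega>. ?f p m) = val u v * ?C2" .
  moreover have "(\<Sum>p\<in>\<Omega>. \<Sum>m\<in>\<Omega>. ?f p m) = (\<Sum>m\<in>\<Omega>. \<Sum>p\<in>\<Omega>. ?f p m)" by (rule sum.swap)
  ultimately show ?thesis using L by simp
qed

section \<open>The adjacency algebra as the matrices constant on colours\<close>

lemma colour_function:
  assumes "\<forall>x\<in>\<Omega>. \<forall>y\<in>\<Omega>. \<forall>u\<in>\<Omega>. \<forall>v\<in>\<Omega>. colour x y = colour u v \<longrightarrow> a x y = a u v"
  obtains c where "\<And>x y. x \<in> \<Omega> \<Longrightarrow> y \<in> \<Omega> \<Longrightarrow> a x y = c (colour x y)"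
proof -
  define c where "c s = (let p = SOME p. p \<in> s in a (fst p) (snd p))" for s
  have "a x y = c (colour x y)" if "x \<in> \<Omega>" "y \<in> \<Omega>" for x y
  proof -
    define p where "p = (SOME p. p \<in> colour x y)"
    have "p \<in> colour x y" unfolding p_def using colour_in(2)[OF that] by (rule someI)
    then have "fst p \<in> \<Omega>" "snd p \<in> \<Omega>" "colour (fst p) (snd p) = colour x y"
      using mem_iff_colour[OF colour_in(1)[OF that], of "fst p" "snd p"] by auto
    then show ?thesis using assms that unfolding c_def p_def[symmetric] Let_def by metis
  qed
  then show ?thesis using that by blast
qed

text \<open>The coefficient of a basis relation is the entry at any of its pairs. Membership thereby
  becomes an entrywise check, from which the closure properties below follow.\<close>

lemma CS_iff:
  "a \<in> CS \<longleftrightarrow> a \<in> mats \<Omega> \<and>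
     (\<forall>x\<in>\<Omega>. \<forall>y\<in>\<Omega>. \<forall>u\<in>\<Omega>. \<forall>v\<in>\<Omega>. colour x y = colour u v \<longrightarrow> a x y = a u v)"
proof -
  have expand: "(\<Sum>s\<in>S. c s * adj s x y) = (if x \<in> \<Omega> \<and> y \<in> \<Omega> then c (colour x y) else 0)" for c x y
  proof -
    have "(\<Sum>s\<in>S. c s * adj s x y) = (\<Sum>s\<in>S. if x \<in> \<Omega> \<and> y \<in> \<Omega> \<and> colour x y = s then c s else 0)"
      by (intro sum.cong) (auto simp: adj_def mem_iff_colour)
    also have "\<dots> = (if x \<in> \<Omega> \<and> y \<in> \<Omega> then c (colour x y) else 0)"
      using finite_S colour_in(1)[of x y] by (auto simp: sum.delta)
    finally show ?thesis .
  qed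
  show ?thesis
  proof
    assume "a \<in> CS"
    then obtain c where "a = (\<lambda>x y. if x \<in> \<Omega> \<and> y \<in> \<Omega> then c (colour x y) else 0)"
      by (auto simp: adj_algebra_def expand)
    then show "a \<in> mats \<Omega> \<and>
     (\<forall>x\<in>\<Omega>. \<forall>y\<in>\<Omega>. \<forall>u\<in>\<Omega>. \<forall>v\<in>\<Omega>. colour x y = colour u v \<longrightarrow> a x y = a u v)"
      by (auto simp: mats_def)
  next
    assume a: "a \<in> mats \<Omega> \<and>
     (\<forall>x\<in>\<Omega>. \<forall>y\<in>\<Omega>. \<forall>u\<in>\<Omega>. \<forall>v\<in>\<Omega>. colour x y = colour u v \<longrightarrow> a x y = a u v)"
    from a obtain c where c: "\<And>x y. x \<in> \<Omega> \<Longrightarrow> y \<in> \<Omega> \<Longrightarrow> a x y = c (colour x y)"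
      using colour_function by blast
    have "a = (\<lambda>x y. \<Sum>s\<in>S. c s * adj s x y)"
    proof (intro ext)
      fix x y
      show "a x y = (\<Sum>s\<in>S. c s * adj s x y)"
        using c[of x y] mats_zero[OF conjunct1[OF a], of x y] unfolding expand by auto
    qed
    then show "a \<in> CS" by (auto simp: adj_algebra_def)
  qed
qed

lemma CS_mats: "a \<in> CS \<Longrightarrow> a \<in> mats \<Omega>"
  by (simp add: CS_iff)

lemma CS_coeff:
  assumes "a \<in> CS"
  obtains c where "\<And>x y. x \<in> \<Omega> \<Longrightarrow> y \<in> \<Omega> \<Longrightarrow> a x y = c (colour x y)"
  using assms colour_function[of a] unfolding CS_iff by blast

lemma CS_I:
  assumes "a \<in> mats \<Omega>"
    and "\<And>x y u v. x \<in> \<Omega> \<Longrightarrow> y \<in> \<Omega> \<Longrightarrow> u \<in> \<Omega> \<Longrightarrow> v \<in> \<Omega> \<Longrightarrow> colour x y = colour u v \<Longrightarrow> a x y = a u v"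
  shows "a \<in> CS"
  unfolding CS_iff by (intro conjI ballI impI assms)

lemma CS_cong:
  assumes "a \<in> CS" "x \<in> \<Omega>" "y \<in> \<Omega>" "u \<in> \<Omega>" "v \<in> \<Omega>" "colour x y = colour u v"
  shows "a x y = a u v"
  by (rule assms(1)[unfolded CS_iff, THEN conjunct2, THEN bspec, OF assms(2), THEN bspec, OF assms(3),
        THEN bspec, OF assms(4), THEN bspec, OF assms(5), THEN mp, OF assms(6)])

lemma CS_transp:
  assumes "a \<in> CS" shows "transp a \<in> CS"
proof (rule CS_I)
  show "transp a \<in> mats \<Omega>" using CS_mats[OF assms] by (auto simp: mats_def transp_def)
  fix x y u v assume *: "x \<in> \<Omega>" "y \<in> \<Omega>" "u \<in> \<Omega>" "v \<in> \<Omega>" "colour x y = colour u v"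
  then have "colour y x = colour v u" by (simp add: colour_swap_eq)
  then show "transp a x y = transp a u v"
    unfolding transp_def using * by (intro CS_cong[OF assms])
qed

lemma CS_adjm:
  assumes "a \<in> CS" shows "adjm a \<in> CS"
proof (rule CS_I)
  show "adjm a \<in> mats \<Omega>" using CS_mats[OF assms] by (auto simp: mats_def adjm_def)
  fix x y u v assume *: "x \<in> \<Omega>" "y \<in> \<Omega>" "u \<in> \<Omega>" "v \<in> \<Omega>" "colour x y = colour u v"
  then have "colour y x = colour v u" by (simp add: colour_swap_eq)
  then show "adjm a x y = adjm a u v"
    unfolding adjm_def using * by (intro arg_cong[of _ _ cnj] CS_cong[OF assms])
qed

lemma CS_diff:
  assumes "a \<in> CS" "b \<in> CS" shows "a - b \<in> CS"
proof (rule CS_I)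
  show "a - b \<in> mats \<Omega>" using CS_mats[OF assms(1)] CS_mats[OF assms(2)] by (simp add: mats_def)
  fix x y u v assume *: "x \<in> \<Omega>" "y \<in> \<Omega>" "u \<in> \<Omega>" "v \<in> \<Omega>" "colour x y = colour u v"
  show "(a - b) x y = (a - b) u v"
    using CS_cong[OF assms(1) *] CS_cong[OF assms(2) *] by simp
qed

lemma CS_scale:
  assumes "a \<in> CS" shows "(\<lambda>x y. c * a x y) \<in> CS"
proof (rule CS_I)
  show "(\<lambda>x y. c * a x y) \<in> mats \<Omega>" using CS_mats[OF assms(1)] by (simp add: mats_def)
  fix x y u v assume *: "x \<in> \<Omega>" "y \<in> \<Omega>" "u \<in> \<Omega>" "v \<in> \<Omega>" "colour x y = colour u v"
  show "c * a x y = c * a u v" using CS_cong[OF assms(1) *] by simp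
qed

lemma CS_Jnorm: "Jnorm \<Omega> \<in> CS"
  by (rule CS_I) (auto simp: mats_def Jnorm_def)

lemma sum_by_colour:
  assumes "\<And>p. p \<in> \<Omega> \<Longrightarrow> f p \<in> S"
  shows "(\<Sum>p\<in>\<Omega>. if Q p then c (f p) else 0) = (\<Sum>t\<in>S. c t * of_nat (card {p\<in>\<Omega>. f p = t \<and> Q p}) :: complex)"
proof -
  have "(\<Sum>t\<in>S. c t * of_nat (card {p\<in>\<Omega>. f p = t \<and> Q p})) =
        (\<Sum>t\<in>S. \<Sum>p\<in>\<Omega>. if f p = t \<and> Q p then c t else 0)"
  proof (rule sum.cong[OF refl])
    fix t
    have "(\<Sum>p\<in>\<Omega>. if f p = t \<and> Q p then c t else 0) = (\<Sum>p | p \<in> \<Omega> \<and> f p = t \<and> Q p. c t)"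
      by (rule sum.inter_filter[OF fin, symmetric])
    then show "c t * of_nat (card {p\<in>\<Omega>. f p = t \<and> Q p}) = (\<Sum>p\<in>\<Omega>. if f p = t \<and> Q p then c t else 0)"
      by (simp add: mult.commute)
  qed
  also have "\<dots> = (\<Sum>p\<in>\<Omega>. \<Sum>t\<in>S. if f p = t \<and> Q p then c t else 0)" by (rule sum.swap)
  also have "\<dots> = (\<Sum>p\<in>\<Omega>. if Q p then c (f p) else 0)"
  proof (rule sum.cong[OF refl])
    fix p assume "p \<in> \<Omega>"
    then have "(\<Sum>t\<in>S. if f p = t then (if Q p then c t else 0) else 0) = (if Q p then c (f p) else 0)"
      using assms finite_S by (subst sum.delta') auto
    moreover have "(\<Sum>t\<in>S. if f p = t \<and> Q p then c t else 0) =
        (\<Sum>t\<in>S. if f p = t then (if Q p then c t else 0) else 0)"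
      by (intro sum.cong) auto
    ultimately show "(\<Sum>t\<in>S. if f p = t \<and> Q p then c t else 0) = (if Q p then c (f p) else 0)" by simp
  qed
  finally show ?thesis by simp
qed

text \<open>Each colour occurs equally often in a row and in a column. This makes the all-one matrix
  central.\<close>

lemma CS_row_sum_eq_col_sum:
  assumes "a \<in> CS" "x \<in> \<Omega>" "y \<in> \<Omega>"
  shows "(\<Sum>p\<in>\<Omega>. a x p) = (\<Sum>p\<in>\<Omega>. a p y)"
proof -
  obtain c where c: "\<And>x y. x \<in> \<Omega> \<Longrightarrow> y \<in> \<Omega> \<Longrightarrow> a x y = c (colour x y)"
    using CS_coeff[OF assms(1)] by blast
  have cards: "card {p\<in>\<Omega>. colour x p = t} = card {p\<in>\<Omega>. colour p y = t}" if t: "t \<in> S" for t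
  proof -
    obtain u v where "(u, v) \<in> t" using S_nonempty[OF t] by auto
    then have "u \<in> \<Omega>" "v \<in> \<Omega>" "colour u v = t" using mem_iff_colour t by auto
    then show ?thesis using card_row[of x u v] card_col[of y u v] assms by auto
  qed
  have "(\<Sum>p\<in>\<Omega>. a x p) = (\<Sum>t\<in>S. c t * of_nat (card {p\<in>\<Omega>. colour x p = t}))"
    using sum_by_colour[of "\<lambda>p. colour x p" "\<lambda>_. True" c] c colour_in assms by simp
  also have "\<dots> = (\<Sum>t\<in>S. c t * of_nat (card {p\<in>\<Omega>. colour p y = t}))"
    using cards by simp
  also have "\<dots> = (\<Sum>p\<in>\<Omega>. a p y)"
    using sum_by_colour[of "\<lambda>p. colour p y" "\<lambda>_. True" c] c colour_in assms by simp
  finally show ?thesis .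
qed

lemma Jnorm_commute:
  assumes "a \<in> CS" shows "mmul \<Omega> (Jnorm \<Omega>) a = mmul \<Omega> a (Jnorm \<Omega>)"
proof (intro ext)
  fix x y
  have a: "a p q = 0" if "p \<notin> \<Omega> \<or> q \<notin> \<Omega>" for p q using CS_mats[OF assms] that by (rule mats_zero)
  show "mmul \<Omega> (Jnorm \<Omega>) a x y = mmul \<Omega> a (Jnorm \<Omega>) x y"
    using CS_row_sum_eq_col_sum[OF assms, of x y] a
    by (auto simp: mmul_def Jnorm_def sum_divide_distrib[symmetric])
qed

text \<open>The entries of the Casimir element \<open>\<Sum>s. (1 / n\<^sub>s) A\<^sub>s \<otimes> A\<^sub>s\<^sup>T\<close> of the adjacency algebra.\<close>

definition casimir :: "'a \<Rightarrow> 'a \<Rightarrow> 'a \<Rightarrow> 'a \<Rightarrow> complex" where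
  "casimir x y v u = (if colour x y = colour v u then 1 / of_nat (val v u) else 0)"

text \<open>The average, with terms (1/n_s) A_s M A_s^T, of the matrix unit \<open>M\<close> at
  position (y, u).\<close>

definition cas_mat :: "'a \<Rightarrow> 'a \<Rightarrow> 'a \<Rightarrow> 'a \<Rightarrow> complex" where
  "cas_mat y u = (\<lambda>x v. if x \<in> \<Omega> \<and> v \<in> \<Omega> then casimir x y v u else 0)"

text \<open>Up to the factor \<open>|\<Omega>|\<close>, the orthogonal projection of the matrix space onto the adjacency algebra.\<close>

definition cas_proj :: "('a \<Rightarrow> 'a \<Rightarrow> complex) \<Rightarrow> 'a \<Rightarrow> 'a \<Rightarrow> complex" where
  "cas_proj Y = (\<lambda>x y. if x \<in> \<Omega> \<and> y \<in> \<Omega> then \<Sum>v\<in>\<Omega>. \<Sum>u\<in>\<Omega>. casimir x y v u * Y v u else 0)"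

text \<open>The element \<open>z\<close> of the overview: entry (x, y) of A_s A_s^T counts the
  points \<open>b\<close> with (x, b) and (y, b) in s.\<close>

definition cas_elt :: "'a \<Rightarrow> 'a \<Rightarrow> complex" where
  "cas_elt = (\<lambda>x y. if x \<in> \<Omega> \<and> y \<in> \<Omega> then \<Sum>b\<in>\<Omega>. casimir x b y b else 0)"

lemma casimir_sym:
  "x \<in> \<Omega> \<Longrightarrow> y \<in> \<Omega> \<Longrightarrow> v \<in> \<Omega> \<Longrightarrow> u \<in> \<Omega> \<Longrightarrow> casimir x y v u = casimir v u x y"
  unfolding casimir_def using val_cong[of x y v u] by auto

lemma casimir_swap:
  "x \<in> \<Omega> \<Longrightarrow> y \<in> \<Omega> \<Longrightarrow> v \<in> \<Omega> \<Longrightarrow> u \<in> \<Omega> \<Longrightarrow> casimir x y v u = casimir y x u v"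
  unfolding casimir_def using colour_swap_eq by (simp add: val_def)

lemma casimir_diag:
  "x \<in> \<Omega> \<Longrightarrow> y \<in> \<Omega> \<Longrightarrow> u \<in> \<Omega> \<Longrightarrow> casimir x y u u = (if x = y then 1 else 0)"
  by (simp add: casimir_def colour_diag colour_diag_iff val_def)

text \<open>Moves \<open>a\<close> from one leg of the Casimir tensor to the other. Grouping both
  sums by the colour \<open>t\<close> at which \<open>a\<close> is evaluated, the coefficients agree
  by \<open>triangle_count\<close>.\<close>

lemma casimir_commute:
  assumes a: "a \<in> CS" and in_\<Omega>: "x \<in> \<Omega>" "y \<in> \<Omega>" "v \<in> \<Omega>" "u \<in> \<Omega>"
  shows "(\<Sum>p\<in>\<Omega>. a x p * casimir p y v u) = (\<Sum>q\<in>\<Omega>. casimir x y q u * a q v)"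
proof -
  obtain c where c: "\<And>x y. x \<in> \<Omega> \<Longrightarrow> y \<in> \<Omega> \<Longrightarrow> a x y = c (colour x y)"
    using CS_coeff[OF a] by blast
  have "(\<Sum>p\<in>\<Omega>. a x p * casimir p y v u) =
        (\<Sum>p\<in>\<Omega>. if colour p y = colour v u then c (colour x p) else 0) / of_nat (val v u)"
    unfolding sum_divide_distrib by (intro sum.cong) (auto simp: casimir_def c in_\<Omega>)
  also have "\<dots> = (\<Sum>t\<in>S. c t * of_nat (card {p\<in>\<Omega>. colour x p = t \<and> colour p y = colour v u})) / of_nat (val v u)"
    by (subst sum_by_colour) (auto simp: colour_in in_\<Omega>)
  also have "\<dots> = (\<Sum>t\<in>S. c t * of_nat (card {q\<in>\<Omega>. colour q v = t \<and> colour q u = colour x y})) / of_nat (val x y)"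
    unfolding sum_divide_distrib
  proof (rule sum.cong[OF refl])
    fix t
    let ?m = "card {p\<in>\<Omega>. colour x p = t \<and> colour p y = colour v u}"
    let ?l = "card {q\<in>\<Omega>. colour q v = t \<and> colour q u = colour x y}"
    have "val x y * ?m = val v u * ?l"
      using triangle_count[of x y v u t] in_\<Omega> by (simp add: conj_commute)
    then have "of_nat (val x y) * of_nat ?m = (of_nat (val v u) * of_nat ?l :: complex)"
      by (simp only: of_nat_mult[symmetric])
    then show "c t * of_nat ?m / of_nat (val v u) = c t * of_nat ?l / of_nat (val x y)"
      using val_pos[of x y] val_pos[of v u] by (simp add: field_simps)
  qed
  also have "\<dots> = (\<Sum>q\<in>\<Omega>. if colour q u = colour x y then c (colour q v) else 0) / of_nat (val x y)"
    by (subst sum_by_colour) (auto simp: colour_in in_\<Omega>)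
  also have "\<dots> = (\<Sum>q\<in>\<Omega>. casimir x y q u * a q v)"
    unfolding sum_divide_distrib
  proof (rule sum.cong[OF refl])
    fix q assume "q \<in> \<Omega>"
    then show "(if colour q u = colour x y then c (colour q v) else 0) / of_nat (val x y) = casimir x y q u * a q v"
      using val_cong[of x y q u] in_\<Omega> by (auto simp: casimir_def c)
  qed
  finally show ?thesis .
qed

lemma cas_mat_mats: "cas_mat y u \<in> mats \<Omega>"
  by (auto simp: cas_mat_def mats_def)

lemma cas_mat_adjm: "y \<in> \<Omega> \<Longrightarrow> u \<in> \<Omega> \<Longrightarrow> adjm (cas_mat y u) = cas_mat u y"
proof (intro ext)
  fix x v assume "y \<in> \<Omega>" "u \<in> \<Omega>"
  moreover have "cnj (casimir p q r s) = casimir p q r s" for p q r s by (simp add: casimir_def)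
  ultimately show "adjm (cas_mat y u) x v = cas_mat u y x v"
    using casimir_sym by (auto simp: adjm_def cas_mat_def)
qed

lemma cas_mat_commute:
  assumes "a \<in> CS" "y \<in> \<Omega>" "u \<in> \<Omega>"
  shows "mmul \<Omega> a (cas_mat y u) = mmul \<Omega> (cas_mat y u) a"
proof (intro ext)
  fix x v
  show "mmul \<Omega> a (cas_mat y u) x v = mmul \<Omega> (cas_mat y u) a x v"
  proof (cases "x \<in> \<Omega> \<and> v \<in> \<Omega>")
    case True
    then show ?thesis using casimir_commute[of a x y v u] assms by (simp add: mmul_def cas_mat_def)
  next
    case False
    then show ?thesis
      using mmul_in_mats[OF CS_mats[OF assms(1)] cas_mat_mats[of y u]]
        mmul_in_mats[OF cas_mat_mats[of y u] CS_mats[OF assms(1)]]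
      by (metis mats_zero)
  qed
qed

lemma cas_proj_CS: "cas_proj Y \<in> CS"
  by (rule CS_I) (simp_all add: cas_proj_def casimir_def mats_def)

text \<open>With \<open>cas_proj_mmul\<close> this makes \<open>cas_proj\<close> a bimodule map over
  the adjacency algebra: \<open>casimir_commute\<close> transfers \<open>a\<close> to the argument,
  and the rest is reordering of sums.\<close>

lemma mmul_cas_proj:
  assumes "a \<in> CS"
  shows "mmul \<Omega> a (cas_proj Y) = cas_proj (mmul \<Omega> a Y)"
proof (intro ext)
  fix x y
  show "mmul \<Omega> a (cas_proj Y) x y = cas_proj (mmul \<Omega> a Y) x y"
  proof (cases "x \<in> \<Omega> \<and> y \<in> \<Omega>")
    case True
    have "mmul \<Omega> a (cas_proj Y) x y = (\<Sum>p\<in>\<Omega>. a x p * (\<Sum>v\<in>\<Omega>. \<Sum>u\<in>\<Omega>. casimir p y v u * Y v u))"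
      using True by (simp add: mmul_def cas_proj_def)
    also have "\<dots> = (\<Sum>p\<in>\<Omega>. \<Sum>v\<in>\<Omega>. \<Sum>u\<in>\<Omega>. a x p * casimir p y v u * Y v u)"
      by (simp add: sum_distrib_left mult.assoc)
    also have "\<dots> = (\<Sum>v\<in>\<Omega>. \<Sum>p\<in>\<Omega>. \<Sum>u\<in>\<Omega>. a x p * casimir p y v u * Y v u)"
      by (rule sum.swap)
    also have "\<dots> = (\<Sum>v\<in>\<Omega>. \<Sum>u\<in>\<Omega>. \<Sum>p\<in>\<Omega>. a x p * casimir p y v u * Y v u)"
      by (rule sum.cong[OF refl], rule sum.swap)
    also have "\<dots> = (\<Sum>v\<in>\<Omega>. \<Sum>u\<in>\<Omega>. (\<Sum>p\<in>\<Omega>. a x p * casimir p y v u) * Y v u)"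
      by (simp add: sum_distrib_right)
    also have "\<dots> = (\<Sum>v\<in>\<Omega>. \<Sum>u\<in>\<Omega>. (\<Sum>q\<in>\<Omega>. casimir x y q u * a q v) * Y v u)"
      using True by (intro sum.cong refl arg_cong2[of _ _ _ _ "(*)"] casimir_commute assms) auto
    also have "\<dots> = (\<Sum>v\<in>\<Omega>. \<Sum>u\<in>\<Omega>. \<Sum>q\<in>\<Omega>. casimir x y q u * (a q v * Y v u))"
      by (simp add: sum_distrib_right mult.assoc)
    also have "\<dots> = (\<Sum>v\<in>\<Omega>. \<Sum>q\<in>\<Omega>. \<Sum>u\<in>\<Omega>. casimir x y q u * (a q v * Y v u))"
      by (rule sum.cong[OF refl], rule sum.swap)
    also have "\<dots> = (\<Sum>q\<in>\<Omega>. \<Sum>v\<in>\<Omega>. \<Sum>u\<in>\<Omega>. casimir x y q u * (a q v * Y v u))"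
      by (rule sum.swap)
    also have "\<dots> = (\<Sum>q\<in>\<Omega>. \<Sum>u\<in>\<Omega>. \<Sum>v\<in>\<Omega>. casimir x y q u * (a q v * Y v u))"
      by (rule sum.cong[OF refl], rule sum.swap)
    also have "\<dots> = cas_proj (mmul \<Omega> a Y) x y"
      using True by (simp add: cas_proj_def mmul_def sum_distrib_left)
    finally show ?thesis .
  next
    case False
    then show ?thesis using mats_zero[OF CS_mats[OF assms]]
      by (auto simp: mmul_def cas_proj_def)
  qed
qed

lemma transp_cas_proj: "transp (cas_proj Y) = cas_proj (transp Y)"
proof (intro ext)
  fix x y
  have "(\<Sum>v\<in>\<Omega>. \<Sum>u\<in>\<Omega>. casimir y x v u * Y v u) = (\<Sum>u\<in>\<Omega>. \<Sum>v\<in>\<Omega>. casimir x y u v * Y v u)"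
    if "x \<in> \<Omega>" "y \<in> \<Omega>"
    by (subst sum.swap, intro sum.cong refl) (simp add: that casimir_swap[of y x])
  then show "transp (cas_proj Y) x y = cas_proj (transp Y) x y"
    by (auto simp: transp_def cas_proj_def)
qed

text \<open>Transposition exchanges left and right multiplication and commutes with
  \<open>cas_proj\<close>.\<close>

lemma cas_proj_mmul:
  assumes "a \<in> CS"
  shows "mmul \<Omega> (cas_proj Y) a = cas_proj (mmul \<Omega> Y a)"
proof -
  have "transp (mmul \<Omega> (cas_proj Y) a) = transp (cas_proj (mmul \<Omega> Y a))"
    unfolding transp_mmul transp_cas_proj mmul_cas_proj[OF CS_transp[OF assms]] ..
  then show ?thesis by (metis transp_transp)
qed

text \<open>Only diagonal pairs share the colour of (x, x), and their weight is 1. So each of the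
  |\<Omega>| diagonal entries of \<open>cas_proj Y\<close> is the trace of \<open>Y\<close>.\<close>

lemma mtrace_cas_proj: "mtrace \<Omega> (cas_proj Y) = of_nat (card \<Omega>) * mtrace \<Omega> Y"
proof -
  have "(\<Sum>u\<in>\<Omega>. casimir x x v u * Y v u) = Y v v" if "x \<in> \<Omega>" "v \<in> \<Omega>" for x v
  proof -
    have "(\<Sum>u\<in>\<Omega>. casimir x x v u * Y v u) = (\<Sum>u\<in>\<Omega>. if u = v then Y v u else 0)"
      using that casimir_sym[of x x v] casimir_diag[of v _ x] by (intro sum.cong) auto
    then show ?thesis using that fin by simp
  qed
  then show ?thesis by (simp add: mtrace_def cas_proj_def)
qed

text \<open>A point \<open>b\<close> related to \<open>x\<close> and \<open>y\<close> by the same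
  colour s is the midpoint of a path from \<open>x\<close> to \<open>y\<close> with colours s and
  its converse. The entry is thus a weighted sum of intersection numbers.\<close>

lemma cas_elt_CS: "cas_elt \<in> CS"
proof -
  define w :: "('a \<times> 'a) set \<Rightarrow> complex" where "w s = (if s = Id_on \<Omega> then 1 else 1 / of_nat k)" for s
  have rep: "(\<Sum>b\<in>\<Omega>. casimir x b y b) =
      (\<Sum>s\<in>S. w s * of_nat (card {b\<in>\<Omega>. colour x b = s \<and> colour b y = converse s}))"
    if xy: "x \<in> \<Omega>" "y \<in> \<Omega>" for x y
  proof -
    have "(\<Sum>b\<in>\<Omega>. casimir x b y b) = (\<Sum>b\<in>\<Omega>. if colour x b = colour y b then w (colour x b) else 0)"
      using xy colour_diag_iff by (intro sum.cong) (auto simp: casimir_def w_def val_def)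
    also have "\<dots> = (\<Sum>s\<in>S. w s * of_nat (card {b\<in>\<Omega>. colour x b = s \<and> colour x b = colour y b}))"
      by (rule sum_by_colour) (use xy colour_in in auto)
    also have "\<dots> = (\<Sum>s\<in>S. w s * of_nat (card {b\<in>\<Omega>. colour x b = s \<and> colour b y = converse s}))"
    proof (rule sum.cong[OF refl])
      fix s
      have "{b\<in>\<Omega>. colour x b = s \<and> colour x b = colour y b} =
         {b\<in>\<Omega>. colour x b = s \<and> colour b y = converse s}"
        using xy colour_converse_iff[of y _ s] by auto
      then show "w s * of_nat (card {b\<in>\<Omega>. colour x b = s \<and> colour x b = colour y b}) =
          w s * of_nat (card {b\<in>\<Omega>. colour x b = s \<and> colour b y = converse s})"
        by (simp only:)
    qed
    finally show ?thesis .
  qed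
  show ?thesis
  proof (rule CS_I)
    show "cas_elt \<in> mats \<Omega>" by (simp add: mats_def cas_elt_def)
    fix x y u v assume *: "x \<in> \<Omega>" "y \<in> \<Omega>" "u \<in> \<Omega>" "v \<in> \<Omega>" "colour x y = colour u v"
    show "cas_elt x y = cas_elt u v"
      unfolding cas_elt_def rep[OF *(1,2)] rep[OF *(3,4)] card_triangles_cong[OF *] using *(1-4) by simp
  qed
qed

lemma cas_elt_commute:
  assumes "a \<in> CS" shows "mmul \<Omega> a cas_elt = mmul \<Omega> cas_elt a"
proof (intro ext)
  fix x y
  show "mmul \<Omega> a cas_elt x y = mmul \<Omega> cas_elt a x y"
  proof (cases "x \<in> \<Omega> \<and> y \<in> \<Omega>")
    case True
    have "mmul \<Omega> a cas_elt x y = (\<Sum>b\<in>\<Omega>. \<Sum>p\<in>\<Omega>. a x p * casimir p b y b)"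
      using True by (subst sum.swap) (simp add: mmul_def cas_elt_def sum_distrib_left)
    also have "\<dots> = (\<Sum>b\<in>\<Omega>. \<Sum>q\<in>\<Omega>. casimir x b q b * a q y)"
      using True by (intro sum.cong refl casimir_commute assms) auto
    also have "\<dots> = mmul \<Omega> cas_elt a x y"
      using True by (subst sum.swap) (simp add: mmul_def cas_elt_def sum_distrib_right)
    finally show ?thesis .
  next
    case False
    then show ?thesis
      using mmul_in_mats[OF CS_mats[OF assms] CS_mats[OF cas_elt_CS]]
        mmul_in_mats[OF CS_mats[OF cas_elt_CS] CS_mats[OF assms]]
      by (metis mats_zero)
  qed
qed

end

section \<open>Central idempotents and irreducible submodules\<close>

lemma mmul_add_left: "mmul \<Omega> (A + B) C = mmul \<Omega> A C + mmul \<Omega> B C"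
  by (auto simp: mmul_def fun_eq_iff algebra_simps sum.distrib)

lemma mmul_diff_left: "mmul \<Omega> (A - B) C = mmul \<Omega> A C - mmul \<Omega> B C"
  by (auto simp: mmul_def fun_eq_iff algebra_simps sum_subtractf)

lemma mmul_diff_right: "mmul \<Omega> C (A - B) = mmul \<Omega> C A - mmul \<Omega> C B"
  by (auto simp: mmul_def fun_eq_iff algebra_simps sum_subtractf)

lemma mvec_scale_left: "mvec \<Omega> (\<lambda>x y. c * A x y) v = cscale c (mvec \<Omega> A v)"
  by (auto simp: mvec_def cscale_def sum_distrib_left mult.assoc)

lemma mvec_mat_zero: "mvec \<Omega> 0 v = 0"
  by (auto simp: mvec_def fun_eq_iff)

lemma mvec_swap: "mmul \<Omega> A B = mmul \<Omega> B A \<Longrightarrow> mvec \<Omega> A (mvec \<Omega> B v) = mvec \<Omega> B (mvec \<Omega> A v)"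
  by (metis mvec_mmul)

lemma subspace_range: "cvec.subspace (mvec \<Omega> A ` vspace \<Omega>)"
  unfolding cvec.subspace_def
proof (intro conjI ballI allI)
  show "0 \<in> mvec \<Omega> A ` vspace \<Omega>"
    using mvec_zero[of \<Omega> A] cvec.subspace_0[OF subspace_vspace, of \<Omega>] by (metis image_eqI)
next
  fix x y assume "x \<in> mvec \<Omega> A ` vspace \<Omega>" "y \<in> mvec \<Omega> A ` vspace \<Omega>"
  then obtain v w where "v \<in> vspace \<Omega>" "w \<in> vspace \<Omega>" "x = mvec \<Omega> A v" "y = mvec \<Omega> A w" by auto
  then show "x + y \<in> mvec \<Omega> A ` vspace \<Omega>"
    using cvec.subspace_add[OF subspace_vspace] mvec_add[of \<Omega> A v w] by (intro image_eqI[of _ _ "v + w"]) auto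
next
  fix c x assume "x \<in> mvec \<Omega> A ` vspace \<Omega>"
  then obtain v where "v \<in> vspace \<Omega>" "x = mvec \<Omega> A v" by auto
  then show "cscale c x \<in> mvec \<Omega> A ` vspace \<Omega>"
    using cvec.subspace_scale[OF subspace_vspace] mvec_cscale[of \<Omega> A c v]
    by (intro image_eqI[of _ _ "cscale c v"]) auto
qed

lemma range_subset_vspace: "mvec \<Omega> A ` vspace \<Omega> \<subseteq> vspace \<Omega>"
  using mvec_in_vspace by auto

lemma submodule_D:
  assumes "submodule \<Omega> S W"
  shows "cvec.subspace W" "W \<subseteq> vspace \<Omega>" "a \<in> adj_algebra S \<Longrightarrow> w \<in> W \<Longrightarrow> mvec \<Omega> a w \<in> W"
  using assms by (auto simp: submodule_def)

context equivalenced_scheme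
begin

section \<open>Central elements and bi-invariant subspaces\<close>

lemma card_\<Omega>_pos: "card \<Omega> > 0"
  using fin nonempty by (simp add: card_gt_0_iff)

definition central :: "('a \<Rightarrow> 'a \<Rightarrow> complex) \<Rightarrow> bool" where
  "central a \<longleftrightarrow> a \<in> CS \<and> (\<forall>b\<in>CS. mmul \<Omega> a b = mmul \<Omega> b a)"

text \<open>The adjacency algebra together with matrices that span its commutant.\<close>

definition ops :: "('a \<Rightarrow> 'a \<Rightarrow> complex) set" where
  "ops = CS \<union> {cas_mat y u | y u. y \<in> \<Omega> \<and> u \<in> \<Omega>}"

text \<open>Plays the part of a sum of isotypic components: invariance under the commuting matrices
  as well is what puts the projection into the algebra.\<close>

definition bi_invariant :: "('a \<Rightarrow> complex) set \<Rightarrow> bool" where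
  "bi_invariant W \<longleftrightarrow> cvec.subspace W \<and> W \<subseteq> vspace \<Omega> \<and> (\<forall>T\<in>ops. \<forall>w\<in>W. mvec \<Omega> T w \<in> W)"

lemma ops_mats: "T \<in> ops \<Longrightarrow> T \<in> mats \<Omega>"
  using CS_mats cas_mat_mats by (auto simp: ops_def)

lemma ops_adjm: "T \<in> ops \<Longrightarrow> adjm T \<in> ops"
  unfolding ops_def using CS_adjm cas_mat_adjm by blast

lemma central_commutes_ops: "central a \<Longrightarrow> T \<in> ops \<Longrightarrow> mmul \<Omega> a T = mmul \<Omega> T a"
  unfolding central_def ops_def using cas_mat_commute by blast

lemma central_mvec_swap:
  "central a \<Longrightarrow> T \<in> ops \<Longrightarrow> mvec \<Omega> T (mvec \<Omega> a v) = mvec \<Omega> a (mvec \<Omega> T v)"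
  by (rule mvec_swap) (simp add: central_commutes_ops)

lemma central_cas_elt: "central cas_elt"
  unfolding central_def using cas_elt_CS cas_elt_commute by metis

lemma central_Jnorm: "central (Jnorm \<Omega>)"
  unfolding central_def using CS_Jnorm Jnorm_commute by metis

lemma central_idem_D:
  assumes "central_idem \<Omega> S P"
  shows "P \<in> CS" "central P" "mmul \<Omega> P P = P" "P \<noteq> 0" "P \<in> mats \<Omega>"
  using assms CS_mats unfolding central_idem_def central_def by auto

lemma central_idem_fix:
  assumes "central_idem \<Omega> S P" "v \<in> mvec \<Omega> P ` vspace \<Omega>"
  shows "mvec \<Omega> P v = v"
  using assms(2) central_idem_D(3)[OF assms(1)] mvec_mmul[of \<Omega> P P] by auto

lemma central_idem_nonzero:
  assumes "central_idem \<Omega> S P"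
  obtains v where "v \<in> vspace \<Omega>" "mvec \<Omega> P v \<noteq> 0"
proof -
  have "\<exists>v\<in>vspace \<Omega>. mvec \<Omega> P v \<noteq> 0"
  proof (rule ccontr)
    assume "\<not> ?thesis"
    then have "P = 0"
      by (intro mats_eqI central_idem_D[OF assms]) (auto simp: mats_def mvec_mat_zero)
    then show False using central_idem_D(4)[OF assms] by simp
  qed
  then show ?thesis using that by blast
qed

lemma bi_invariant_range:
  assumes "central a" shows "bi_invariant (mvec \<Omega> a ` vspace \<Omega>)"
  unfolding bi_invariant_def
proof (intro conjI ballI)
  fix T w assume "T \<in> ops" "w \<in> mvec \<Omega> a ` vspace \<Omega>"
  then show "mvec \<Omega> T w \<in> mvec \<Omega> a ` vspace \<Omega>"
    by (auto simp: central_mvec_swap[OF assms] intro!: imageI mvec_in_vspace)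
qed (rule subspace_range, rule range_subset_vspace)

lemma submodule_range:
  assumes "central a" shows "submodule \<Omega> S (mvec \<Omega> a ` vspace \<Omega>)"
  using bi_invariant_range[OF assms] unfolding bi_invariant_def submodule_def ops_def by blast

text \<open>A concrete double centraliser argument. Summing over \<open>u\<close> the entries (x, u)
  of the two products of \<open>?E\<close> with \<open>cas_mat y u\<close> gives |\<Omega>| times
  \<open>?E x y\<close> on one side and \<open>cas_proj ?E x y\<close> on the other, so
  \<open>?E\<close> is a multiple of a matrix in the algebra.\<close>

lemma bi_invariant_proj:
  assumes W: "bi_invariant W" and B: "onb \<Omega> W B"
  shows "central (onb_proj B)"
proof -
  let ?E = "onb_proj B"
  have sub: "W \<subseteq> vspace \<Omega>" "cvec.subspace W" using W by (auto simp: bi_invariant_def)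
  have comm: "mmul \<Omega> T ?E = mmul \<Omega> ?E T" if "T \<in> ops" for T
    using W ops_adjm[OF that] that
    by (intro onb_proj_commute[OF B sub] ops_mats) (auto simp: bi_invariant_def)
  have "of_nat (card \<Omega>) * ?E x y = cas_proj ?E x y" if xy: "x \<in> \<Omega>" "y \<in> \<Omega>" for x y
  proof -
    have "of_nat (card \<Omega>) * ?E x y = (\<Sum>u\<in>\<Omega>. \<Sum>p\<in>\<Omega>. if p = y then ?E x p else 0)"
      using fin xy by simp
    also have "\<dots> = (\<Sum>u\<in>\<Omega>. mmul \<Omega> ?E (cas_mat y u) x u)"
    proof (rule sum.cong[OF refl])
      fix u assume "u \<in> \<Omega>"
      then show "(\<Sum>p\<in>\<Omega>. if p = y then ?E x p else 0) = mmul \<Omega> ?E (cas_mat y u) x u"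
        unfolding mmul_def using xy by (intro sum.cong) (auto simp: cas_mat_def casimir_diag)
    qed
    also have "\<dots> = (\<Sum>u\<in>\<Omega>. mmul \<Omega> (cas_mat y u) ?E x u)"
    proof (rule sum.cong[OF refl])
      fix u assume "u \<in> \<Omega>"
      then have "cas_mat y u \<in> ops" using xy by (auto simp: ops_def)
      from comm[OF this] show "mmul \<Omega> ?E (cas_mat y u) x u = mmul \<Omega> (cas_mat y u) ?E x u" by simp
    qed
    also have "\<dots> = (\<Sum>u\<in>\<Omega>. \<Sum>q\<in>\<Omega>. casimir x y q u * ?E q u)"
      using xy by (intro sum.cong refl) (simp add: mmul_def cas_mat_def)
    also have "\<dots> = cas_proj ?E x y" unfolding cas_proj_def using xy by (subst sum.swap) simp
    finally show ?thesis .
  qed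
  then have "?E x y = (1 / of_nat (card \<Omega>)) * cas_proj ?E x y" for x y
    using mats_zero[OF onb_proj_in_mats[OF B sub(1)], of x y] card_\<Omega>_pos
    by (cases "x \<in> \<Omega> \<and> y \<in> \<Omega>") (auto simp: field_simps cas_proj_def)
  then have "?E = (\<lambda>x y. (1 / of_nat (card \<Omega>)) * cas_proj ?E x y)" by (intro ext)
  then have "?E \<in> CS" using CS_scale[OF cas_proj_CS] by metis
  then show ?thesis unfolding central_def using comm by (auto simp: ops_def)
qed

lemma proj_idem:
  assumes B: "onb \<Omega> W B" "W \<subseteq> vspace \<Omega>" "cvec.subspace W"
  shows "mmul \<Omega> (onb_proj B) (onb_proj B) = onb_proj B"
proof (rule mats_eqI)
  show "mvec \<Omega> (mmul \<Omega> (onb_proj B) (onb_proj B)) v = mvec \<Omega> (onb_proj B) v" for v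
    unfolding mvec_mmul by (rule mvec_onb_proj_id[OF B(1,2) mvec_onb_proj_in[OF B]])
qed (intro mmul_in_mats onb_proj_in_mats[OF B(1,2)])+

lemma bi_invariant_central_idem:
  assumes W: "bi_invariant W" and B: "onb \<Omega> W B" and "W \<noteq> {0}"
  shows "central_idem \<Omega> S (onb_proj B)"
proof -
  have sub: "W \<subseteq> vspace \<Omega>" "cvec.subspace W" using W by (auto simp: bi_invariant_def)
  obtain w where "w \<in> W" "w \<noteq> 0" using cvec.subspace_0[OF sub(2)] assms(3) by blast
  then have "onb_proj B \<noteq> 0"
    using mvec_onb_proj_id[OF B sub(1)] mvec_mat_zero by metis
  then show ?thesis
    using bi_invariant_proj[OF W B] proj_idem[OF B sub] unfolding central_idem_def central_def by blast
qed

text \<open>A central idempotent is the orthogonal projection \<open>?E\<close> onto its range: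
  \<open>?E P = P\<close> and \<open>P ?E = ?E\<close>, and the two commute. The trace of
  \<open>?E\<close> is the dimension of the range.\<close>

lemma mtrace_central_idem:
  assumes P: "central_idem \<Omega> S P"
  shows "mtrace \<Omega> P = of_nat (rk \<Omega> P)"
proof -
  let ?W = "mvec \<Omega> P ` vspace \<Omega>"
  have bi: "bi_invariant ?W" by (rule bi_invariant_range[OF central_idem_D(2)[OF P]])
  obtain B where B: "onb \<Omega> ?W B" using onb_exists[OF subspace_range range_subset_vspace] .
  let ?E = "onb_proj B"
  have "P = mmul \<Omega> ?E P"
    by (rule mats_eqI)
      (auto simp: central_idem_D[OF P] mvec_mmul mvec_onb_proj_id[OF B range_subset_vspace]
        intro!: mmul_in_mats onb_proj_in_mats[OF B range_subset_vspace])
  also have "\<dots> = mmul \<Omega> P ?E"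
    using bi_invariant_proj[OF bi B] central_idem_D(1)[OF P] by (auto simp: central_def)
  also have "\<dots> = ?E"
    by (rule mats_eqI)
      (auto simp: central_idem_D[OF P] mvec_mmul
        central_idem_fix[OF P mvec_onb_proj_in[OF B range_subset_vspace subspace_range]]
        intro!: mmul_in_mats onb_proj_in_mats[OF B range_subset_vspace])
  finally have "P = ?E" .
  then show ?thesis
    unfolding rk_def cdim_onb[OF subspace_range B] using mtrace_onb_proj[OF B] by simp
qed

text \<open>The eigenvectors of \<open>y\<close> for \<mu> in the range of \<open>P\<close>, with 0,
  form a nonzero bi-invariant subspace \<open>N\<close>. Its projection is a central idempotent
  below \<open>P\<close>, and primitivity forces the two to coincide.\<close>

lemma central_scalar_on_primitive:
  assumes P: "P \<in> central_prim_idems \<Omega> S" and y: "central y"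
    and w: "w \<in> mvec \<Omega> P ` vspace \<Omega>" "w \<noteq> 0" "mvec \<Omega> y w = cscale \<mu> w"
    and v: "v \<in> mvec \<Omega> P ` vspace \<Omega>"
  shows "mvec \<Omega> y v = cscale \<mu> v"
proof -
  have Pc: "central_idem \<Omega> S P" using P by (auto simp: central_prim_idems_def)
  note PD = central_idem_D[OF Pc]
  define N where "N = {v \<in> vspace \<Omega>. mvec \<Omega> P v = v \<and> mvec \<Omega> y v = cscale \<mu> v}"
  have "cvec.subspace N"
    unfolding cvec.subspace_def N_def
    using subspace_vspace[of \<Omega>]
    by (auto simp: mvec_add mvec_cscale mvec_zero cvec.subspace_add cvec.subspace_scale cvec.subspace_0
        cvec.scale_right_distrib mult.commute)
  moreover have "mvec \<Omega> T x \<in> N" if "T \<in> ops" "x \<in> N" for T x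
    using that mvec_in_vspace[of \<Omega> T x] mvec_cscale[of \<Omega> T \<mu> x] unfolding N_def
    by (auto simp: central_mvec_swap[OF PD(2), symmetric] central_mvec_swap[OF y, symmetric])
  ultimately have bi: "bi_invariant N" unfolding bi_invariant_def by (auto simp: N_def)
  then have sub: "N \<subseteq> vspace \<Omega>" "cvec.subspace N" by (auto simp: bi_invariant_def)
  have wN: "w \<in> N" using w central_idem_fix[OF Pc w(1)] range_subset_vspace unfolding N_def by auto
  obtain B where B: "onb \<Omega> N B" using onb_exists sub by metis
  let ?E = "onb_proj B"
  have E: "central_idem \<Omega> S ?E" by (rule bi_invariant_central_idem[OF bi B]) (use wN w(2) in blast)
  note ED = central_idem_D[OF E]
  have PE: "mmul \<Omega> P ?E = ?E"
  proof (rule mats_eqI)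
    show "mvec \<Omega> (mmul \<Omega> P ?E) v = mvec \<Omega> ?E v" for v
      using mvec_onb_proj_in[OF B sub, of v] unfolding mvec_mmul N_def by auto
  qed (use PD ED in \<open>auto intro: mmul_in_mats\<close>)
  have EP: "mmul \<Omega> ?E P = ?E" using PE ED(2) PD(1) by (simp add: central_def)
  have "P - ?E = 0"
  proof (rule ccontr)
    assume n0: "P - ?E \<noteq> 0"
    have idem: "mmul \<Omega> (P - ?E) (P - ?E) = P - ?E"
      by (simp add: mmul_diff_left mmul_diff_right PD(3) ED(3) PE EP)
    have comm: "mmul \<Omega> (P - ?E) A = mmul \<Omega> A (P - ?E)" if "A \<in> CS" for A
      using PD(2) ED(2) that by (simp add: mmul_diff_left mmul_diff_right central_def)
    have "central_idem \<Omega> S (P - ?E)"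
      unfolding central_idem_def by (intro conjI ballI CS_diff PD(1) ED(1) n0 idem comm)
    moreover have "mmul \<Omega> ?E (P - ?E) = 0" by (simp add: mmul_diff_right EP ED(3))
    moreover have "P = ?E + (P - ?E)" by simp
    ultimately show False using P E unfolding central_prim_idems_def by blast
  qed
  then have "P = ?E" by simp
  then have "v \<in> N" using v mvec_onb_proj_in[OF B sub] by auto
  then show ?thesis by (simp add: N_def)
qed

section \<open>Schur's lemma and the ingredients of the orthogonality relations\<close>

lemma schur:
  assumes W: "irreducible_submodule \<Omega> S W"
    and T: "\<And>a. a \<in> CS \<Longrightarrow> mmul \<Omega> a T = mmul \<Omega> T a" "\<And>w. w \<in> W \<Longrightarrow> mvec \<Omega> T w \<in> W"
  obtains l where "\<And>w. w \<in> W \<Longrightarrow> mvec \<Omega> T w = cscale l w"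
proof -
  have sm: "submodule \<Omega> S W" "W \<noteq> {0}" using W by (auto simp: irreducible_submodule_def)
  note smD = submodule_D[OF sm(1)]
  obtain w l where w: "w \<in> W" "w \<noteq> 0" "mvec \<Omega> T w = cscale l w"
    using eigenvector_exists[OF smD(1,2) sm(2) T(2)] .
  \<comment> \<open>As \<open>T\<close> commutes with the algebra, its eigenspace inside
    \<open>W\<close> is a submodule, which by irreducibility is all of \<open>W\<close>.\<close>
  define U where "U = {u \<in> W. mvec \<Omega> T u = cscale l u}"
  have "cvec.subspace U"
    unfolding cvec.subspace_def U_def using smD(1)
    by (auto simp: mvec_add mvec_cscale mvec_zero cvec.subspace_add cvec.subspace_scale cvec.subspace_0
        cvec.scale_right_distrib mult.commute)
  moreover have "mvec \<Omega> a u \<in> U" if "a \<in> CS" "u \<in> U" for a u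
    using that smD(3) mvec_swap[OF T(1)[OF that(1)], of u] mvec_cscale[of \<Omega> a l u] by (auto simp: U_def)
  ultimately have "submodule \<Omega> S U" using smD(2) by (auto simp: submodule_def U_def)
  then have "U = {0} \<or> U = W" using W by (auto simp: irreducible_submodule_def U_def)
  then have "U = W" using w by (auto simp: U_def)
  then show ?thesis using that by (auto simp: U_def)
qed

text \<open>The average, with terms (1/n_s) A_s M A_s^T, of the rank-one matrix \<open>M\<close>
  with entries \<open>e y * cnj (f u)\<close>: the intertwiner of Schur's orthogonality
  relations.\<close>

definition sandwich :: "('a \<Rightarrow> complex) \<Rightarrow> ('a \<Rightarrow> complex) \<Rightarrow> 'a \<Rightarrow> 'a \<Rightarrow> complex" where
  "sandwich e f = (\<lambda>x v. if x \<in> \<Omega> \<and> v \<in> \<Omega> then \<Sum>y\<in>\<Omega>. \<Sum>u\<in>\<Omega>. e y * cnj (f u) * casimir x y v u else 0)"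

lemma sandwich_mats: "sandwich e f \<in> mats \<Omega>"
  by (auto simp: sandwich_def mats_def)

lemma sandwich_commute:
  assumes a: "a \<in> CS" shows "mmul \<Omega> a (sandwich e f) = mmul \<Omega> (sandwich e f) a"
proof (intro ext)
  fix x v
  show "mmul \<Omega> a (sandwich e f) x v = mmul \<Omega> (sandwich e f) a x v"
  proof (cases "x \<in> \<Omega> \<and> v \<in> \<Omega>")
    case True
    have "mmul \<Omega> a (sandwich e f) x v = (\<Sum>p\<in>\<Omega>. \<Sum>y\<in>\<Omega>. \<Sum>u\<in>\<Omega>. e y * cnj (f u) * (a x p * casimir p y v u))"
      using True by (simp add: mmul_def sandwich_def sum_distrib_left mult_ac)
    also have "\<dots> = (\<Sum>y\<in>\<Omega>. \<Sum>p\<in>\<Omega>. \<Sum>u\<in>\<Omega>. e y * cnj (f u) * (a x p * casimir p y v u))"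
      by (rule sum.swap)
    also have "\<dots> = (\<Sum>y\<in>\<Omega>. \<Sum>u\<in>\<Omega>. \<Sum>p\<in>\<Omega>. e y * cnj (f u) * (a x p * casimir p y v u))"
      by (rule sum.cong[OF refl], rule sum.swap)
    also have "\<dots> = (\<Sum>y\<in>\<Omega>. \<Sum>u\<in>\<Omega>. e y * cnj (f u) * (\<Sum>p\<in>\<Omega>. a x p * casimir p y v u))"
      by (simp add: sum_distrib_left)
    also have "\<dots> = (\<Sum>y\<in>\<Omega>. \<Sum>u\<in>\<Omega>. e y * cnj (f u) * (\<Sum>q\<in>\<Omega>. casimir x y q u * a q v))"
      using True by (intro sum.cong[OF refl] arg_cong2[of _ _ _ _ "(*)"] refl casimir_commute[OF a]) auto
    also have "\<dots> = (\<Sum>y\<in>\<Omega>. \<Sum>u\<in>\<Omega>. \<Sum>q\<in>\<Omega>. e y * cnj (f u) * casimir x y q u * a q v)"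
      by (simp add: sum_distrib_left mult.assoc)
    also have "\<dots> = (\<Sum>y\<in>\<Omega>. \<Sum>q\<in>\<Omega>. \<Sum>u\<in>\<Omega>. e y * cnj (f u) * casimir x y q u * a q v)"
      by (rule sum.cong[OF refl], rule sum.swap)
    also have "\<dots> = (\<Sum>q\<in>\<Omega>. \<Sum>y\<in>\<Omega>. \<Sum>u\<in>\<Omega>. e y * cnj (f u) * casimir x y q u * a q v)"
      by (rule sum.swap)
    also have "\<dots> = mmul \<Omega> (sandwich e f) a x v"
      using True by (simp add: mmul_def sandwich_def sum_distrib_right)
    finally show ?thesis .
  next
    case False
    then show ?thesis
      using mmul_in_mats[OF CS_mats[OF a] sandwich_mats[of e f]]
        mmul_in_mats[OF sandwich_mats[of e f] CS_mats[OF a]]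
      by (metis mats_zero)
  qed
qed

text \<open>The same four-index sum read along the other leg. It exhibits the image of
  \<open>v\<close> as an element of the algebra applied to \<open>e\<close>, which therefore stays
  in any submodule containing \<open>e\<close>.\<close>

lemma mvec_sandwich: "mvec \<Omega> (sandwich e f) v = mvec \<Omega> (cas_proj (\<lambda>p u. v p * cnj (f u))) e"
proof
  fix x
  show "mvec \<Omega> (sandwich e f) v x = mvec \<Omega> (cas_proj (\<lambda>p u. v p * cnj (f u))) e x"
  proof (cases "x \<in> \<Omega>")
    case True
    have "mvec \<Omega> (sandwich e f) v x = (\<Sum>p\<in>\<Omega>. \<Sum>y\<in>\<Omega>. \<Sum>u\<in>\<Omega>. casimir x y p u * (v p * cnj (f u)) * e y)"
      using True by (simp add: mvec_def sandwich_def sum_distrib_left sum_distrib_right mult_ac)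
    also have "\<dots> = (\<Sum>y\<in>\<Omega>. \<Sum>p\<in>\<Omega>. \<Sum>u\<in>\<Omega>. casimir x y p u * (v p * cnj (f u)) * e y)"
      by (rule sum.swap)
    also have "\<dots> = mvec \<Omega> (cas_proj (\<lambda>p u. v p * cnj (f u))) e x"
      using True by (simp add: mvec_def cas_proj_def sum_distrib_right)
    finally show ?thesis .
  qed (simp add: mvec_def)
qed

text \<open>Taking the trace identifies one index of each leg, and this contraction of the Casimir
  tensor is \<open>cas_elt\<close>.\<close>

lemma mtrace_sandwich: "mtrace \<Omega> (sandwich e f) = ip \<Omega> (mvec \<Omega> cas_elt e) f"
proof -
  have "mtrace \<Omega> (sandwich e f) = (\<Sum>x\<in>\<Omega>. \<Sum>y\<in>\<Omega>. \<Sum>u\<in>\<Omega>. e y * cnj (f u) * casimir u x y x)"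
    unfolding mtrace_def
  proof (rule sum.cong[OF refl])
    fix x assume x: "x \<in> \<Omega>"
    have "casimir x y x u = casimir u x y x" if "y \<in> \<Omega>" "u \<in> \<Omega>" for y u
      using casimir_swap[of x y x u] casimir_sym[of y x u x] x that by simp
    then show "sandwich e f x x = (\<Sum>y\<in>\<Omega>. \<Sum>u\<in>\<Omega>. e y * cnj (f u) * casimir u x y x)"
      using x by (simp add: sandwich_def)
  qed
  also have "\<dots> = (\<Sum>y\<in>\<Omega>. \<Sum>x\<in>\<Omega>. \<Sum>u\<in>\<Omega>. e y * cnj (f u) * casimir u x y x)"
    by (rule sum.swap)
  also have "\<dots> = (\<Sum>y\<in>\<Omega>. \<Sum>u\<in>\<Omega>. \<Sum>x\<in>\<Omega>. e y * cnj (f u) * casimir u x y x)"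
    by (rule sum.cong[OF refl], rule sum.swap)
  also have "\<dots> = (\<Sum>u\<in>\<Omega>. \<Sum>y\<in>\<Omega>. \<Sum>x\<in>\<Omega>. e y * cnj (f u) * casimir u x y x)"
    by (rule sum.swap)
  also have "\<dots> = ip \<Omega> (mvec \<Omega> cas_elt e) f"
    by (simp add: ip_def mvec_def cas_elt_def sum_distrib_left sum_distrib_right mult_ac)
  finally show ?thesis .
qed

text \<open>Splits the projection into its rank-one parts and applies \<open>mvec_sandwich\<close>
  to each.\<close>

lemma mvec_cas_proj_onb:
  "mvec \<Omega> (cas_proj (onb_proj B)) e = (\<lambda>x. \<Sum>f\<in>B. mvec \<Omega> (sandwich e f) f x)"
proof
  fix x
  show "mvec \<Omega> (cas_proj (onb_proj B)) e x = (\<Sum>f\<in>B. mvec \<Omega> (sandwich e f) f x)"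
  proof (cases "x \<in> \<Omega>")
    case True
    have proj: "cas_proj (onb_proj B) x y = (\<Sum>f\<in>B. cas_proj (\<lambda>p u. f p * cnj (f u)) x y)" for y
    proof (cases "y \<in> \<Omega>")
      case y: True
      have "cas_proj (onb_proj B) x y = (\<Sum>v\<in>\<Omega>. \<Sum>u\<in>\<Omega>. \<Sum>f\<in>B. casimir x y v u * (f v * cnj (f u)))"
        using True y by (simp add: cas_proj_def onb_proj_def sum_distrib_left)
      also have "\<dots> = (\<Sum>v\<in>\<Omega>. \<Sum>f\<in>B. \<Sum>u\<in>\<Omega>. casimir x y v u * (f v * cnj (f u)))"
        by (rule sum.cong[OF refl], rule sum.swap)
      also have "\<dots> = (\<Sum>f\<in>B. \<Sum>v\<in>\<Omega>. \<Sum>u\<in>\<Omega>. casimir x y v u * (f v * cnj (f u)))"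
        by (rule sum.swap)
      finally show ?thesis using True y by (simp add: cas_proj_def)
    qed (simp add: cas_proj_def)
    have "mvec \<Omega> (cas_proj (onb_proj B)) e x = (\<Sum>y\<in>\<Omega>. \<Sum>f\<in>B. cas_proj (\<lambda>p u. f p * cnj (f u)) x y * e y)"
      using True by (simp add: mvec_def proj sum_distrib_right)
    also have "\<dots> = (\<Sum>f\<in>B. \<Sum>y\<in>\<Omega>. cas_proj (\<lambda>p u. f p * cnj (f u)) x y * e y)" by (rule sum.swap)
    also have "\<dots> = (\<Sum>f\<in>B. mvec \<Omega> (sandwich e f) f x)"
      unfolding mvec_sandwich using True by (simp add: mvec_def)
    finally show ?thesis .
  qed (simp add: mvec_def)
qed

end

section \<open>Pseudocyclic schemes\<close>

context equivalenced_scheme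
begin

text \<open>Gives meaning to the \<open>SOME\<close> in \<open>nP\<close>: a nonzero submodule of
  least dimension in the range of \<open>P\<close> is irreducible.\<close>

lemma corresponding_exists:
  assumes P: "central_idem \<Omega> S P"
  shows "\<exists>W. corresponds \<Omega> S P W"
proof -
  let ?V = "mvec \<Omega> P ` vspace \<Omega>"
  obtain v where "v \<in> vspace \<Omega>" "mvec \<Omega> P v \<noteq> 0" using central_idem_nonzero[OF P] .
  then have V: "submodule \<Omega> S ?V \<and> ?V \<noteq> {0}"
    using submodule_range[OF central_idem_D(2)[OF P]] by blast
  have sub: "cvec.subspace U \<and> U \<subseteq> vspace \<Omega> \<and> U \<noteq> {0}" if "submodule \<Omega> S U \<and> U \<noteq> {0}" for U
    using that by (auto simp: submodule_def)
  obtain M where M: "submodule \<Omega> S M \<and> M \<noteq> {0}" "M \<subseteq> ?V"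
      "\<And>U. submodule \<Omega> S U \<and> U \<noteq> {0} \<Longrightarrow> U \<subseteq> M \<Longrightarrow> U = M"
    by (rule minimal_subspace_exists[where Q = "\<lambda>U. submodule \<Omega> S U \<and> U \<noteq> {0}", OF V sub]) (assumption, rule that)
  then have "corresponds \<Omega> S P M"
    unfolding corresponds_def irreducible_submodule_def by blast
  then show ?thesis ..
qed

text \<open>The scalar by which the Casimir element acts is found by comparing the traces of
  \<open>cas_proj E\<close>, where \<open>E\<close> projects onto an irreducible \<open>W\<close>: this matrix is central, hence a
  multiple of \<open>P\<close>, and Schur's orthogonality relations show how it acts on \<open>W\<close>.\<close>

lemma cas_elt_on_primitive:
  assumes P: "P \<in> central_prim_idems \<Omega> S" and corr: "corresponds \<Omega> S P W"
  obtains \<omega> where "\<And>v. v \<in> mvec \<Omega> P ` vspace \<Omega> \<Longrightarrow> mvec \<Omega> cas_elt v = cscale \<omega> v"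
    and "\<omega> * of_nat (rk \<Omega> P) = of_nat (card \<Omega> * (cdim W)\<^sup>2)" and "cdim W > 0"
proof -
  have Pc: "central_idem \<Omega> S P" using P by (auto simp: central_prim_idems_def)
  note PD = central_idem_D[OF Pc]
  have irr: "irreducible_submodule \<Omega> S W" and WP: "W \<subseteq> mvec \<Omega> P ` vspace \<Omega>"
    using corr by (auto simp: corresponds_def)
  have sm: "submodule \<Omega> S W" "W \<noteq> {0}" using irr by (auto simp: irreducible_submodule_def)
  note smD = submodule_D[OF sm(1)]
  obtain B where B: "onb \<Omega> W B" using onb_exists[OF smD(1,2)] .
  have B': "finite B" "B \<subseteq> W" "orthonormal \<Omega> B" using B by (auto simp: onb_def)
  have ipB: "ip \<Omega> e f = (if e = f then 1 else 0)" if "e \<in> B" "f \<in> B" for e f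
    using B'(3) that unfolding orthonormal_def by blast
  obtain w where "w \<in> W" "w \<noteq> 0" using sm(2) cvec.subspace_0[OF smD(1)] by blast
  have "B \<noteq> {}"
  proof
    assume "B = {}"
    then have "w = 0" using B \<open>w \<in> W\<close> unfolding onb_def by (auto simp: fun_eq_iff)
    then show False using \<open>w \<noteq> 0\<close> by simp
  qed
  then obtain e0 where e0: "e0 \<in> B" by blast
  then have "e0 \<in> W" "e0 \<noteq> 0" using B' ipB[OF e0 e0] by (auto simp: ip_def)
  define d where "d = card B"
  have dW: "cdim W = d" unfolding d_def by (rule cdim_onb[OF smD(1) B])
  have d0: "d > 0" using B' e0 by (auto simp: d_def card_gt_0_iff)
  define E where "E = onb_proj B"
  have E_mats: "E \<in> mats \<Omega>" unfolding E_def by (rule onb_proj_in_mats[OF B smD(2)])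
  have E_in: "mvec \<Omega> E v \<in> W" for v unfolding E_def by (rule mvec_onb_proj_in[OF B smD(2,1)])
  have E_id: "mvec \<Omega> E v = v" if "v \<in> W" for v
    unfolding E_def by (rule mvec_onb_proj_id[OF B smD(2) that])
  have E_tr: "mtrace \<Omega> E = of_nat d" unfolding E_def d_def by (rule mtrace_onb_proj[OF B])
  have E_comm: "mmul \<Omega> a E = mmul \<Omega> E a" if "a \<in> CS" for a
    unfolding E_def using that
    by (intro onb_proj_commute[OF B smD(2,1)] CS_mats smD(3) CS_adjm)
  obtain \<omega> where \<omega>: "\<And>w. w \<in> W \<Longrightarrow> mvec \<Omega> cas_elt w = cscale \<omega> w"
    using schur[OF irr cas_elt_commute smD(3)[OF cas_elt_CS]] by blast
  \<comment> \<open>Schur orthogonality. The intertwiner acts on \<open>W\<close> as a scalar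
    \<open>l\<close> and maps every vector into \<open>W\<close>, so its trace is l d; by
    \<open>mtrace_sandwich\<close> the trace is also \<omega> times the inner product of
    \<open>e\<close> and \<open>f\<close>.\<close>
  have H: "mvec \<Omega> (sandwich e f) w = cscale (if e = f then \<omega> / of_nat d else 0) w"
    if ef: "e \<in> B" "f \<in> B" and w: "w \<in> W" for e f w
  proof -
    have H_in: "mvec \<Omega> (sandwich e f) v \<in> W" for v
      unfolding mvec_sandwich using ef B' by (intro smD(3) cas_proj_CS) auto
    obtain l where l: "\<And>w. w \<in> W \<Longrightarrow> mvec \<Omega> (sandwich e f) w = cscale l w"
      using schur[OF irr sandwich_commute H_in] by blast
    have HE: "mmul \<Omega> (sandwich e f) E = (\<lambda>x y. l * E x y)"
    proof (rule mats_eqI)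
      show "(\<lambda>x y. l * E x y) \<in> mats \<Omega>" using E_mats by (simp add: mats_def)
      show "mvec \<Omega> (mmul \<Omega> (sandwich e f) E) v = mvec \<Omega> (\<lambda>x y. l * E x y) v" for v
        unfolding mvec_mmul mvec_scale_left by (rule l[OF E_in])
    qed (intro mmul_in_mats sandwich_mats E_mats)
    have EH: "mmul \<Omega> E (sandwich e f) = sandwich e f"
    proof (rule mats_eqI)
      show "mvec \<Omega> (mmul \<Omega> E (sandwich e f)) v = mvec \<Omega> (sandwich e f) v" for v
        unfolding mvec_mmul by (rule E_id[OF H_in])
    qed (intro mmul_in_mats sandwich_mats E_mats)+
    have "l * of_nat d = mtrace \<Omega> (mmul \<Omega> (sandwich e f) E)"
      unfolding HE E_tr[symmetric] by (simp add: mtrace_def sum_distrib_left)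
    also have "\<dots> = mtrace \<Omega> (sandwich e f)"
      by (subst mtrace_mmul_commute) (simp add: EH)
    also have "\<dots> = ip \<Omega> (cscale \<omega> e) f"
      unfolding mtrace_sandwich using \<omega>[of e] ef B' by auto
    also have "\<dots> = \<omega> * ip \<Omega> e f" by (simp add: ip_def cscale_def sum_distrib_left mult.assoc)
    also have "\<dots> = (if e = f then \<omega> else 0)" using ipB[OF ef] by simp
    finally have "l = (if e = f then \<omega> / of_nat d else 0)"
      using d0 by (simp add: field_simps split: if_splits)
    then show ?thesis using l[OF w] by simp
  qed
  define y where "y = cas_proj E"
  have y_central: "central y"
    unfolding central_def y_def using cas_proj_CS mmul_cas_proj cas_proj_mmul E_comm by metis
  \<comment> \<open>Of the terms indexed by the basis, only \<open>f = e0\<close> survives the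
    orthogonality relations.\<close>
  have y_e0: "mvec \<Omega> y e0 = cscale (\<omega> / of_nat d) e0"
  proof
    fix x
    have "mvec \<Omega> y e0 x = (\<Sum>f\<in>B. mvec \<Omega> (sandwich e0 f) f x)"
      unfolding y_def E_def mvec_cas_proj_onb ..
    also have "\<dots> = (\<Sum>f\<in>B. if f = e0 then \<omega> / of_nat d * f x else 0)"
      using H[OF e0] B' by (intro sum.cong) (auto simp: cscale_def)
    also have "\<dots> = cscale (\<omega> / of_nat d) e0 x" using B' e0 by (simp add: cscale_def)
    finally show "mvec \<Omega> y e0 x = cscale (\<omega> / of_nat d) e0 x" .
  qed
  have e0P: "e0 \<in> mvec \<Omega> P ` vspace \<Omega>" using \<open>e0 \<in> W\<close> WP by blast
  have yP: "mmul \<Omega> y P = y"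
  proof -
    have "mmul \<Omega> P E = E"
    proof (rule mats_eqI)
      show "mvec \<Omega> (mmul \<Omega> P E) v = mvec \<Omega> E v" for v
        unfolding mvec_mmul using E_in WP by (intro central_idem_fix[OF Pc]) blast
    qed (intro mmul_in_mats PD(5) E_mats)+
    then have "mmul \<Omega> E P = E" using E_comm[OF PD(1)] by simp
    then show ?thesis unfolding y_def cas_proj_mmul[OF PD(1)] by simp
  qed
  \<comment> \<open>The eigenvalue found at \<open>e0\<close> spreads over the whole range of
    \<open>P\<close>. Comparing traces then gives |\<Omega>| d = (\<omega> / d) rk P.\<close>
  have "mmul \<Omega> y P = (\<lambda>x z. \<omega> / of_nat d * P x z)"
  proof (rule mats_eqI)
    show "(\<lambda>x z. \<omega> / of_nat d * P x z) \<in> mats \<Omega>" using PD(5) by (simp add: mats_def)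
    show "mmul \<Omega> y P \<in> mats \<Omega>" using y_central CS_mats unfolding central_def by (intro mmul_in_mats PD(5)) auto
    show "mvec \<Omega> (mmul \<Omega> y P) v = mvec \<Omega> (\<lambda>x z. \<omega> / of_nat d * P x z) v" if "v \<in> vspace \<Omega>" for v
      unfolding mvec_mmul mvec_scale_left
      by (rule central_scalar_on_primitive[OF P y_central e0P \<open>e0 \<noteq> 0\<close> y_e0 imageI[OF that]])
  qed
  then have "mtrace \<Omega> y = \<omega> / of_nat d * of_nat (rk \<Omega> P)"
    unfolding yP mtrace_central_idem[OF Pc, symmetric] by (simp add: mtrace_def sum_distrib_left)
  moreover have "mtrace \<Omega> y = of_nat (card \<Omega>) * of_nat d"
    unfolding y_def mtrace_cas_proj E_tr ..
  ultimately have "\<omega> * of_nat (rk \<Omega> P) = of_nat (card \<Omega> * d\<^sup>2)"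
    using d0 by (simp add: field_simps power2_eq_square)
  moreover have "mvec \<Omega> cas_elt v = cscale \<omega> v" if "v \<in> mvec \<Omega> P ` vspace \<Omega>" for v
    by (rule central_scalar_on_primitive[OF P central_cas_elt e0P \<open>e0 \<noteq> 0\<close> \<omega>[OF \<open>e0 \<in> W\<close>] that])
  ultimately show ?thesis using that d0 dW by blast
qed

lemma cas_elt_adjm: "adjm cas_elt = cas_elt"
proof (intro ext)
  fix x y
  have "cnj (casimir y b x b) = casimir x b y b" if "x \<in> \<Omega>" "y \<in> \<Omega>" "b \<in> \<Omega>" for b
    using casimir_sym[of x b y b] that by (simp add: casimir_def)
  then show "adjm cas_elt x y = cas_elt x y"
    by (simp add: adjm_def cas_elt_def)
qed

lemma pseudocyclic_scalar:
  assumes "pseudocyclic \<Omega> S"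
  obtains \<omega> :: real where "\<And>P v. P \<in> central_prim_idems \<Omega> S - {Jnorm \<Omega>} \<Longrightarrow>
    v \<in> mvec \<Omega> P ` vspace \<Omega> \<Longrightarrow> mvec \<Omega> cas_elt v = cscale (of_real \<omega>) v"
proof -
  obtain c where c: "\<And>P. P \<in> central_prim_idems \<Omega> S - {Jnorm \<Omega>} \<Longrightarrow> mP \<Omega> S P / real (nP \<Omega> S P) = c"
    using assms unfolding pseudocyclic_def by blast
  \<comment> \<open>By \<omega> rk P = |\<Omega>| n_P^2 and m_P = rk P / n_P, the scalar is
    |\<Omega>| divided by m_P / n_P, the quantity assumed to be constant.\<close>
  have "mvec \<Omega> cas_elt v = cscale (of_real (real (card \<Omega>) / c)) v"
    if P: "P \<in> central_prim_idems \<Omega> S - {Jnorm \<Omega>}" and v: "v \<in> mvec \<Omega> P ` vspace \<Omega>" for P v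
  proof -
    define W where "W = (SOME W. corresponds \<Omega> S P W)"
    have "corresponds \<Omega> S P W" unfolding W_def
      by (rule someI_ex, rule corresponding_exists) (use P in \<open>auto simp: central_prim_idems_def\<close>)
    then obtain \<omega> where \<omega>: "\<And>v. v \<in> mvec \<Omega> P ` vspace \<Omega> \<Longrightarrow> mvec \<Omega> cas_elt v = cscale \<omega> v"
      and eq: "\<omega> * of_nat (rk \<Omega> P) = of_nat (card \<Omega> * (cdim W)\<^sup>2)" and pos: "cdim W > 0"
      using cas_elt_on_primitive P by (metis DiffD1)
    have nP: "nP \<Omega> S P = cdim W" by (simp add: nP_def W_def)
    have c_eq: "c = real (rk \<Omega> P) / real ((cdim W)\<^sup>2)"
      using c[OF P] by (simp add: mP_def nP power2_eq_square)
    have rk0: "rk \<Omega> P \<noteq> 0"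
    proof
      assume "rk \<Omega> P = 0"
      then have "(of_nat (card \<Omega> * (cdim W)\<^sup>2) :: complex) = 0" using eq by simp
      then show False unfolding of_nat_eq_0_iff using pos card_\<Omega>_pos by simp
    qed
    have "\<omega> = of_nat (card \<Omega> * (cdim W)\<^sup>2) / of_nat (rk \<Omega> P)"
      using eq rk0 by (simp add: field_simps)
    also have "\<dots> = of_real (real (card \<Omega>) / c)"
      unfolding c_eq by simp
    finally show ?thesis using \<omega>[OF v] by simp
  qed
  then show ?thesis using that by blast
qed

text \<open>In a splitting into orthogonal central idempotents \<open>R1\<close> and
  \<open>R2\<close>, both ranges lie in \<open>Q\<close>, and by minimality the range of
  \<open>R1\<close> is \<open>Q\<close>. Then \<open>R1\<close> fixes the range of
  \<open>R2\<close>, although their product is 0.\<close>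

lemma minimal_bi_invariant_primitive:
  assumes Q: "bi_invariant Q" "Q \<noteq> {0}" and B: "onb \<Omega> Q B"
    and min: "\<And>U. bi_invariant U \<Longrightarrow> U \<noteq> {0} \<Longrightarrow> U \<subseteq> Q \<Longrightarrow> U = Q"
  shows "onb_proj B \<in> central_prim_idems \<Omega> S"
proof -
  let ?E = "onb_proj B"
  have sub: "Q \<subseteq> vspace \<Omega>" "cvec.subspace Q" using Q by (auto simp: bi_invariant_def)
  have False if R: "central_idem \<Omega> S R1" "central_idem \<Omega> S R2" "mmul \<Omega> R1 R2 = 0" "?E = R1 + R2" for R1 R2
  proof -
    note D1 = central_idem_D[OF R(1)] and D2 = central_idem_D[OF R(2)]
    have "mmul \<Omega> R2 R1 = 0" using R(3) D1(2) D2(1) by (simp add: central_def)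
    then have E1: "mmul \<Omega> ?E R1 = R1" unfolding R(4) mmul_add_left D1(3) by simp
    have E2: "mmul \<Omega> ?E R2 = R2" unfolding R(4) mmul_add_left D2(3) R(3) by simp
    have in1: "mvec \<Omega> R1 v \<in> Q" for v
      using mvec_onb_proj_in[OF B sub, of "mvec \<Omega> R1 v"] E1 mvec_mmul[of \<Omega> ?E R1 v] by simp
    have in2: "mvec \<Omega> R2 v \<in> Q" for v
      using mvec_onb_proj_in[OF B sub, of "mvec \<Omega> R2 v"] E2 mvec_mmul[of \<Omega> ?E R2 v] by simp
    obtain v where "v \<in> vspace \<Omega>" "mvec \<Omega> R1 v \<noteq> 0" using central_idem_nonzero[OF R(1)] .
    then have ne: "mvec \<Omega> R1 ` vspace \<Omega> \<noteq> {0}" by blast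
    have Q1: "mvec \<Omega> R1 ` vspace \<Omega> = Q"
      by (rule min[OF bi_invariant_range[OF D1(2)] ne]) (use in1 in auto)
    obtain u where u: "u \<in> vspace \<Omega>" "mvec \<Omega> R2 u \<noteq> 0" using central_idem_nonzero[OF R(2)] .
    have "mvec \<Omega> R2 u = mvec \<Omega> R1 (mvec \<Omega> R2 u)"
      using central_idem_fix[OF R(1)] in2[of u] Q1 by simp
    also have "\<dots> = 0" using R(3) by (simp add: mvec_mmul[symmetric] mvec_mat_zero)
    finally show False using u(2) by simp
  qed
  then show ?thesis
    using bi_invariant_central_idem[OF Q(1) B Q(2)] unfolding central_prim_idems_def by blast
qed

text \<open>With \<omega> the common scalar, the defect \<open>D\<close> of \<open>cas_elt\<close>
  maps the sum-zero vectors onto a bi-invariant subspace. A minimal one inside it would belong to a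
  primitive idempotent other than \<open>Jnorm\<close>, and so consist of eigenvectors for
  \<omega>.\<close>

lemma cas_elt_on_sum_zero:
  assumes "pseudocyclic \<Omega> S"
  obtains \<omega> :: real where "\<And>v. v \<in> vspace \<Omega> \<Longrightarrow> mvec \<Omega> (Jnorm \<Omega>) v = 0 \<Longrightarrow>
    mvec \<Omega> cas_elt v = cscale (of_real \<omega>) v"
proof -
  obtain \<omega> :: real where \<omega>: "\<And>P v. P \<in> central_prim_idems \<Omega> S - {Jnorm \<Omega>} \<Longrightarrow>
    v \<in> mvec \<Omega> P ` vspace \<Omega> \<Longrightarrow> mvec \<Omega> cas_elt v = cscale (of_real \<omega>) v"
    using pseudocyclic_scalar[OF assms] by blast
  define D where "D v = mvec \<Omega> cas_elt v - cscale (of_real \<omega>) v" for v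
  define V0 where "V0 = {v \<in> vspace \<Omega>. mvec \<Omega> (Jnorm \<Omega>) v = 0}"
  have D_add: "D v + D w = D (v + w)" for v w
    by (simp add: D_def mvec_add cvec.scale_right_distrib)
  have D_scale: "cscale c (D v) = D (cscale c v)" for c v
    by (simp add: D_def mvec_cscale cvec.scale_right_diff_distrib mult.commute)
  have D_zero: "D 0 = 0" by (simp add: D_def mvec_zero)
  have D_ops: "mvec \<Omega> T (D v) = D (mvec \<Omega> T v)" if "T \<in> ops" for T v
    by (simp add: D_def mvec_diff mvec_cscale central_mvec_swap[OF central_cas_elt that])
  have V0_sub: "cvec.subspace V0"
    unfolding cvec.subspace_def V0_def using subspace_vspace[of \<Omega>]
    by (auto simp: mvec_add mvec_cscale mvec_zero cvec.subspace_add cvec.subspace_scale cvec.subspace_0)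
  have V0_ops: "mvec \<Omega> T v \<in> V0" if "T \<in> ops" "v \<in> V0" for T v
    using that(2) central_mvec_swap[OF central_Jnorm that(1), of v]
    by (simp add: V0_def mvec_in_vspace mvec_zero)
  have DV: "D v \<in> vspace \<Omega>" if "v \<in> V0" for v
    unfolding D_def using that mvec_in_vspace
    by (intro cvec.subspace_diff[OF subspace_vspace] cvec.subspace_scale[OF subspace_vspace]) (auto simp: V0_def)
  have bi: "bi_invariant (D ` V0)"
    unfolding bi_invariant_def cvec.subspace_def
  proof (intro conjI ballI allI)
    show "0 \<in> D ` V0" using D_zero cvec.subspace_0[OF V0_sub] by (metis image_eqI)
    show "D ` V0 \<subseteq> vspace \<Omega>" using DV by blast
    show "x + y \<in> D ` V0" if "x \<in> D ` V0" "y \<in> D ` V0" for x y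
      using that by (auto simp: D_add intro!: imageI cvec.subspace_add[OF V0_sub])
    show "cscale c x \<in> D ` V0" if "x \<in> D ` V0" for c x
      using that by (auto simp: D_scale intro!: imageI cvec.subspace_scale[OF V0_sub])
    show "mvec \<Omega> T x \<in> D ` V0" if "T \<in> ops" "x \<in> D ` V0" for T x
      using that by (auto simp: D_ops intro!: imageI V0_ops)
  qed
  have "D ` V0 = {0}"
  proof (rule ccontr)
    assume "D ` V0 \<noteq> {0}"
    then have V: "bi_invariant (D ` V0) \<and> D ` V0 \<noteq> {0}" using bi by blast
    have bi_sub: "cvec.subspace U \<and> U \<subseteq> vspace \<Omega> \<and> U \<noteq> {0}" if "bi_invariant U \<and> U \<noteq> {0}" for U
      using that by (auto simp: bi_invariant_def)
    obtain Q where Q: "bi_invariant Q \<and> Q \<noteq> {0}" "Q \<subseteq> D ` V0"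
        "\<And>U. bi_invariant U \<and> U \<noteq> {0} \<Longrightarrow> U \<subseteq> Q \<Longrightarrow> U = Q"
      by (rule minimal_subspace_exists[where Q = "\<lambda>U. bi_invariant U \<and> U \<noteq> {0}", OF V bi_sub]) (assumption, rule that)
    have sub: "Q \<subseteq> vspace \<Omega>" "cvec.subspace Q" using Q(1) by (auto simp: bi_invariant_def)
    obtain B where B: "onb \<Omega> Q B" using onb_exists[OF sub(2,1)] .
    have prim: "onb_proj B \<in> central_prim_idems \<Omega> S"
      using Q by (intro minimal_bi_invariant_primitive[OF _ _ B]) auto
    obtain q where q: "q \<in> Q" "q \<noteq> 0" using Q(1) cvec.subspace_0[OF sub(2)] by blast
    obtain v where v: "v \<in> V0" "q = D v" using q Q(2) by blast
    have Eq: "mvec \<Omega> (onb_proj B) q = q" by (rule mvec_onb_proj_id[OF B sub(1) q(1)])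
    have "mvec \<Omega> (Jnorm \<Omega>) q = 0"
      unfolding v(2) using D_ops[of "Jnorm \<Omega>" v] CS_Jnorm v(1) D_zero by (auto simp: ops_def V0_def)
    then have "onb_proj B \<noteq> Jnorm \<Omega>" using Eq q(2) by auto
    then have "mvec \<Omega> cas_elt q = cscale (of_real \<omega>) q"
      using \<omega>[of "onb_proj B" q] prim Eq q(1) sub(1) by (metis DiffI image_eqI singletonD subsetD)
    \<comment> \<open>\<open>cas_elt\<close> is Hermitian and \<omega> is real, so \<open>D\<close>
      moves across the inner product: \<open>q\<close> is \<open>D v\<close> and \<open>D\<close>
      kills \<open>q\<close>, hence \<open>q\<close> is orthogonal to itself.\<close>
    then have "ip \<Omega> (mvec \<Omega> cas_elt v) q = ip \<Omega> v (cscale (of_real \<omega>) q)"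
      by (simp add: ip_mvec[of _ cas_elt] cas_elt_adjm)
    also have "\<dots> = ip \<Omega> (cscale (of_real \<omega>) v) q"
      by (simp add: ip_def cscale_def mult_ac)
    finally have "ip \<Omega> q q = 0" by (subst v(2)) (simp add: D_def ip_diff_left)
    then show False using ip_self_eq_0 q sub(1) by blast
  qed
  then have "D v = 0" if "v \<in> V0" for v using that by blast
  then have "mvec \<Omega> cas_elt v = cscale (of_real \<omega>) v" if "v \<in> V0" for v
    using that by (simp add: D_def)
  then show ?thesis using that by (auto simp: V0_def)
qed

text \<open>Constancy comes from the scalar action on sum-zero vectors, the value k - 1 from
  counting pairs (u, b) with \<open>colour x b = colour u b\<close> in two ways.\<close>

lemma indistinguishing_number:
  assumes pc: "pseudocyclic \<Omega> S" and xy: "x \<in> \<Omega>" "y \<in> \<Omega>" "x \<noteq> y"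
  shows "card {b\<in>\<Omega>. colour x b = colour y b} = k - 1"
proof -
  obtain \<omega> :: real where \<omega>: "\<And>v. v \<in> vspace \<Omega> \<Longrightarrow> mvec \<Omega> (Jnorm \<Omega>) v = 0 \<Longrightarrow>
    mvec \<Omega> cas_elt v = cscale (of_real \<omega>) v"
    using cas_elt_on_sum_zero[OF pc] by blast
  let ?c = "\<lambda>x y. card {b\<in>\<Omega>. colour x b = colour y b}"
  have z: "cas_elt x u = of_nat (?c x u) / of_nat k" if u: "u \<in> \<Omega>" "u \<noteq> x" for u
  proof -
    \<comment> \<open>A matching \<open>b\<close> differs from \<open>u\<close>, since
      \<open>colour u u\<close> is the diagonal while \<open>x\<close> is not \<open>u\<close>. So
      every matching term has weight 1/k.\<close>
    have "cas_elt x u = (\<Sum>b\<in>\<Omega>. if colour x b = colour u b then 1 / of_nat k else 0)"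
      unfolding cas_elt_def using xy u colour_diag_iff[of _ _] colour_diag
      by (auto simp: casimir_def val_def intro!: sum.cong) (metis colour_diag colour_diag_iff)
    also have "\<dots> = (\<Sum>b\<in>{b\<in>\<Omega>. colour x b = colour u b}. 1 / of_nat k)"
      by (rule sum.inter_filter[OF fin, symmetric])
    finally show ?thesis by simp
  qed
  have const: "?c x u = ?c x y" if u: "u \<in> \<Omega>" "u \<noteq> x" for u
  proof -
    let ?d = "\<lambda>y x. if x = y then 1 else (0::complex)"
    \<comment> \<open>A sum-zero vector vanishing at \<open>x\<close>: evaluating the eigenvector
      equation there equates two entries of row \<open>x\<close>.\<close>
    let ?v = "?d u - ?d y"
    have "?v \<in> vspace \<Omega>" using u xy by (auto simp: vspace_def)
    moreover have "mvec \<Omega> (Jnorm \<Omega>) ?v = 0"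
    proof
      fix p
      show "mvec \<Omega> (Jnorm \<Omega>) ?v p = 0 p"
        unfolding mvec_diff minus_apply using mvec_delta[of u p "Jnorm \<Omega>"] mvec_delta[of y p "Jnorm \<Omega>"] u xy
        by (cases "p \<in> \<Omega>") (auto simp: Jnorm_def mvec_def)
    qed
    ultimately have "mvec \<Omega> cas_elt ?v = cscale (of_real \<omega>) ?v" by (rule \<omega>)
    then have "mvec \<Omega> cas_elt ?v x = cscale (of_real \<omega>) ?v x" by (rule fun_cong)
    then have "cas_elt x u - cas_elt x y = 0"
      unfolding mvec_diff minus_apply
      using mvec_delta[of u x cas_elt] mvec_delta[of y x cas_elt] u xy by (simp add: cscale_def)
    then have "(of_nat (?c x u) :: complex) = of_nat (?c x y)"
      using z[OF u] z[OF xy(2)] xy k_pos by simp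
    then show ?thesis by (simp only: of_nat_eq_iff)
  qed
  have card_sum: "card {m\<in>A. Q m} = (\<Sum>m\<in>A. if Q m then 1 else 0)" if "finite A" for A :: "'a set" and Q
    using that by (simp add: sum.If_cases Int_def)
  have fin': "finite (\<Omega> - {x})" using fin by simp
  have "card (\<Omega> - {x}) * ?c x y = (\<Sum>u\<in>\<Omega> - {x}. ?c x u)" using const by simp
  also have "\<dots> = (\<Sum>u\<in>\<Omega> - {x}. \<Sum>b\<in>\<Omega>. if colour x b = colour u b then 1 else 0)"
    by (simp only: card_sum[OF fin])
  also have "\<dots> = (\<Sum>b\<in>\<Omega>. \<Sum>u\<in>\<Omega> - {x}. if colour x b = colour u b then 1 else 0)" by (rule sum.swap)
  also have "\<dots> = (\<Sum>b\<in>\<Omega>. card {u\<in>\<Omega> - {x}. colour x b = colour u b})"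
    by (simp only: card_sum[OF fin'])
  \<comment> \<open>Among the \<open>val x b\<close> points that see \<open>b\<close> as
    \<open>x\<close> does, one is \<open>x\<close> itself; for \<open>b = x\<close> there is no
    other.\<close>
  also have "\<dots> = (\<Sum>b\<in>\<Omega>. if b = x then 0 else k - 1)"
  proof (rule sum.cong[OF refl])
    fix b assume b: "b \<in> \<Omega>"
    have "{u\<in>\<Omega> - {x}. colour x b = colour u b} = {u\<in>\<Omega>. colour u b = colour x b} - {x}" by auto
    moreover have "x \<in> {u\<in>\<Omega>. colour u b = colour x b}" using xy by simp
    ultimately have "card {u\<in>\<Omega> - {x}. colour x b = colour u b} = val x b - 1"
      using card_col[OF b xy(1) b] fin by (simp add: card_Diff_singleton)
    then show "card {u\<in>\<Omega> - {x}. colour x b = colour u b} = (if b = x then 0 else k - 1)"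
      by (auto simp: val_def)
  qed
  also have "\<dots> = (\<Sum>b\<in>\<Omega> - {x}. k - 1)"
    using fin xy by (subst sum.remove[of _ x]) (auto intro!: sum.cong)
  finally have "card (\<Omega> - {x}) * ?c x y = card (\<Omega> - {x}) * (k - 1)" by simp
  moreover have "card (\<Omega> - {x}) \<noteq> 0" using fin' xy card_eq_0_iff[of "\<Omega> - {x}"] by blast
  ultimately show ?thesis by simp
qed

end

section \<open>Semiregularity\<close>

context equivalenced_scheme
begin

text \<open>Valencies are positive, so every basis relation occurs as a colour in the row of a fixed
  point. It converts the hypothesis on |S| into one on |\<Omega>|.\<close>

lemma card_S_le: "card S \<le> card \<Omega>"
proof -
  obtain a where a: "a \<in> \<Omega>" using nonempty by blast
  have "s \<in> colour a ` \<Omega>" if s: "s \<in> S" for s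
  proof -
    obtain u v where uv: "u \<in> \<Omega>" "v \<in> \<Omega>" "colour u v = s"
      using S_nonempty[OF s] mem_iff_colour[OF s] by (metis ex_in_conv surj_pair)
    have "card {y\<in>\<Omega>. colour a y = colour u v} \<noteq> 0" using card_row[OF a uv(1,2)] val_pos by simp
    then have "{y\<in>\<Omega>. colour a y = colour u v} \<noteq> {}" by (metis card.empty)
    then show ?thesis using uv(3) by blast
  qed
  then show ?thesis by (meson card_image_le card_mono fin finite_imageI order_trans subsetI)
qed

definition bad_points :: "'a \<Rightarrow> 'a \<Rightarrow> 'a set" where
  "bad_points a b = {d\<in>\<Omega>. \<exists>b'\<in>\<Omega>. b' \<noteq> b \<and> colour a b' = colour a b \<and> colour b' d = colour b d}"

text \<open>The bad points are covered by k - 1 sets, one for each other point \<open>b'\<close> in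
  the relation of \<open>b\<close> from \<open>a\<close>, and each has k - 1 elements by
  \<open>indistinguishing_number\<close>.\<close>

lemma card_bad_points:
  assumes "pseudocyclic \<Omega> S" "a \<in> \<Omega>" "b \<in> \<Omega>" "a \<noteq> b"
  shows "card (bad_points a b) \<le> (k - 1) * (k - 1)"
proof -
  let ?I = "{b'\<in>\<Omega>. colour a b' = colour a b} - {b}"
  have finI: "finite ?I" using fin by simp
  have "card {b'\<in>\<Omega>. colour a b' = colour a b} = k"
    using card_row[of a a b] assms by (simp add: val_def)
  then have cardI: "card ?I = k - 1" using assms by (simp add: card_Diff_singleton)
  have "bad_points a b = (\<Union>b'\<in>?I. {d\<in>\<Omega>. colour b' d = colour b d})"
    by (auto simp: bad_points_def)
  then have "card (bad_points a b) \<le> (\<Sum>b'\<in>?I. card {d\<in>\<Omega>. colour b' d = colour b d})"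
    using card_UN_le[OF finI] by simp
  also have "\<dots> = (\<Sum>b'\<in>?I. k - 1)"
    by (rule sum.cong[OF refl]) (use indistinguishing_number[OF assms(1)] assms(3) in auto)
  also have "\<dots> = (k - 1) * (k - 1)" using cardI by simp
  finally show ?thesis .
qed

text \<open>All valencies being equal, the number of common neighbours of prescribed colours
  is the same at \<open>b\<close> as at \<open>d\<close>.\<close>

lemma not_bad_point_unique:
  assumes in_\<Omega>: "a \<in> \<Omega>" "b \<in> \<Omega>" "d \<in> \<Omega>" "d' \<in> \<Omega>" and ne: "a \<noteq> b" "a \<noteq> d"
    and good: "d \<notin> bad_points a b"
    and d': "colour a d' = colour a d" "colour b d' = colour b d"
  shows "d' = d"
proof -
  \<comment> \<open>That \<open>d\<close> is not bad for \<open>b\<close> says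
    \<open>?P = {b}\<close>. In \<open>triangle_count\<close> both valencies are \<open>k\<close>,
    so \<open>?M\<close> is a singleton as well, and it contains \<open>d\<close> and
    \<open>d'\<close>.\<close>
  let ?M = "{m\<in>\<Omega>. colour b m = colour b d \<and> colour m a = colour d a}"
  let ?P = "{p\<in>\<Omega>. colour p a = colour b a \<and> colour p d = colour b d}"
  have "?P = {b}"
    using good in_\<Omega> colour_swap_eq[of a _ a b] by (auto simp: bad_points_def)
  moreover have "val b a * card ?M = val d a * card ?P"
    by (rule triangle_count) (use in_\<Omega> in auto)
  ultimately have "card ?M = 1" using ne k_pos by (simp add: val_def)
  then obtain m where m: "?M = {m}" by (auto simp: card_1_singleton_iff)
  have "colour d' a = colour d a" using colour_swap_eq[of a d' a d] d' in_\<Omega> by simp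
  then have "d' \<in> ?M" using d' in_\<Omega> by simp
  moreover have "d \<in> ?M" using in_\<Omega> by simp
  ultimately show ?thesis unfolding m by simp
qed

lemma admissible_colour_eq:
  assumes T: "alpha_admissible \<Omega> S a T" and v: "v \<in> T" "(b, d) \<in> v" "(b', d') \<in> v"
  shows "colour b d = colour b' d'"
proof -
  have cc: "coherent_config \<Omega> T" using T by (simp add: alpha_admissible_def)
  have bd: "b \<in> \<Omega>" "d \<in> \<Omega>" using v coherent_configD(3)[OF cc] by blast+
  have "union_of T (colour b d)" using T colour_in[OF bd] by (auto simp: alpha_admissible_def)
  then have "v \<subseteq> colour b d" using union_of_subset[OF cc _ v(1,2)] colour_in[OF bd] by blast
  then show ?thesis using v(3) colour_eqI[OF colour_in(1)[OF bd]] by auto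
qed

text \<open>Relations of \<open>T\<close> remember the colour of their endpoint from
  \<open>a\<close>. The path from \<open>b\<close> through \<open>a\<close> to \<open>d\<close> is
  copied to a path from \<open>b'\<close> to \<open>d'\<close>, and its midpoint must again be
  \<open>a\<close>.\<close>

lemma admissible_point_colour_eq:
  assumes T: "alpha_admissible \<Omega> S a T" and a: "a \<in> \<Omega>" and v: "v \<in> T" "(b, d) \<in> v" "(b', d') \<in> v"
  shows "colour a d = colour a d'"
proof -
  have cc: "coherent_config \<Omega> T" using T by (simp add: alpha_admissible_def)
  have bd: "b \<in> \<Omega>" "d \<in> \<Omega>" using v coherent_configD(3)[OF cc] by blast+
  have "(a, a) \<in> \<Union>T" "(a, d) \<in> \<Union>T" "(b, a) \<in> \<Union>T"
    using coherent_configD(3)[OF cc] a bd by auto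
  then obtain i w r where i: "i \<in> T" "(a, a) \<in> i" and w: "w \<in> T" "(a, d) \<in> w"
    and r: "r \<in> T" "(b, a) \<in> r" by blast
  have "union_of T {(a, a)}" using T by (simp add: alpha_admissible_def)
  then have ia: "i \<subseteq> {(a, a)}" by (rule union_of_subset[OF cc _ i]) simp
  obtain z where z: "(b', z) \<in> r" "(z, d') \<in> w"
    using coherent_config_path[OF cc r(1) w(1) v r(2) w(2)] .
  \<comment> \<open>Copying the degenerate path a, a, d along \<open>w\<close> makes
    \<open>z\<close> the first point of a pair in \<open>i\<close>, which is contained in {(a,
    a)}.\<close>
  obtain z' where "(z, z') \<in> i" using coherent_config_path[OF cc i(1) w(1) w(1) w(2) z(2) i(2) w(2)] .
  then have "z = a" using ia by blast
  then show ?thesis using admissible_colour_eq[OF T w z(2)] by simp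
qed

lemma admissible_semiregular:
  assumes pc: "pseudocyclic \<Omega> S" and large: "card S > 2 * k * (k - 1) + 2"
    and T: "alpha_admissible \<Omega> S a T" and a: "a \<in> \<Omega>"
  shows "semiregular_off \<Omega> T a"
  unfolding semiregular_off_def
proof (intro ballI impI)
  fix s b assume s: "s \<in> T" "s \<subseteq> (\<Omega> - {a}) \<times> (\<Omega> - {a})" and b: "b \<in> \<Omega> - {a}"
  have cc: "coherent_config \<Omega> T" using T by (simp add: alpha_admissible_def)
  have "g' = g" if g: "g \<in> nbr b s" and g': "g' \<in> nbr b s" for g g'
  proof -
    have gs: "(b, g) \<in> s" "(b, g') \<in> s" using g g' by (auto simp: nbr_def)
    then have g\<Omega>: "g \<in> \<Omega>" "a \<noteq> g" "g' \<in> \<Omega>" using s(2) by auto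
    have b\<Omega>: "b \<in> \<Omega>" "a \<noteq> b" using b by auto
    let ?X = "insert a (bad_points a b \<union> bad_points a g)"
    have finX: "finite (bad_points a b \<union> bad_points a g)" using fin by (simp add: bad_points_def)
    \<comment> \<open>One for \<open>a\<close> and (k-1)^2 for each bad set; (k-1)^2 \<le> k(k-1)
      brings this to the form of the hypothesis.\<close>
    have "card ?X \<le> 1 + ((k - 1) * (k - 1) + (k - 1) * (k - 1))"
      using card_bad_points[OF pc a b\<Omega>] card_bad_points[OF pc a g\<Omega>(1,2)]
        card_Un_le[of "bad_points a b" "bad_points a g"] card_insert_if[OF finX, of a] by (auto split: if_splits)
    also have "\<dots> \<le> 1 + (k * (k - 1) + k * (k - 1))"
      by (intro add_mono mult_right_mono order_refl) auto
    also have "\<dots> < card \<Omega>" using large card_S_le by simp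
    finally have "\<not> \<Omega> \<subseteq> ?X" using card_mono[of ?X \<Omega>] finX by (metis finite_insert leD)
    then obtain d where d: "d \<in> \<Omega>" "a \<noteq> d" "d \<notin> bad_points a b" "d \<notin> bad_points a g" by blast
    have "(b, d) \<in> \<Union>T" "(d, g) \<in> \<Union>T" using coherent_configD(3)[OF cc] b\<Omega> d g\<Omega> by auto
    then obtain v w where v: "v \<in> T" "(b, d) \<in> v" and w: "w \<in> T" "(d, g) \<in> w" by blast
    \<comment> \<open>The path from \<open>b\<close> through \<open>d\<close> to \<open>g\<close> is
      copied onto the pair (b, g'). As \<open>d\<close> is not bad for \<open>b\<close>, the copied
      midpoint is \<open>d\<close> again.\<close>
    obtain d' where d': "(b, d') \<in> v" "(d', g') \<in> w"
      using coherent_config_path[OF cc v(1) w(1) s(1) gs v(2) w(2)] .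
    have d'\<Omega>: "d' \<in> \<Omega>" using d' v(1) coherent_configD(3)[OF cc] by blast
    have "d' = d"
      using admissible_colour_eq[OF T v d'(1)] admissible_point_colour_eq[OF T a v d'(1)]
      by (intro not_bad_point_unique[OF a b\<Omega>(1) d(1) d'\<Omega> b\<Omega>(2) d(2,3)]) simp_all
    then have dg': "(d, g') \<in> w" using d' by simp
    \<comment> \<open>\<open>g\<close> and \<open>g'\<close> now have the same colours from
      \<open>a\<close> and to \<open>d\<close>; were they distinct, \<open>d\<close> would be bad
      for \<open>g\<close>.\<close>
    have "colour d g = colour d g'" by (rule admissible_colour_eq[OF T w dg'])
    then have "colour g' d = colour g d"
      using colour_swap_eq[of d g' d g] d(1) g\<Omega> by simp
    moreover have "colour a g' = colour a g" using admissible_point_colour_eq[OF T a w dg'] by simp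
    ultimately show "g' = g" using d(1,4) g\<Omega> unfolding bad_points_def by blast
  qed
  then show "card (nbr b s) \<le> 1"
    by (metis card_le_Suc0_iff_eq card.infinite One_nat_def zero_le)
qed

end

theorem theorem7p2:
  fixes \<Omega> :: "'a set" and S :: "('a \<times> 'a) set set" and k :: nat
  assumes "pseudocyclic \<Omega> S"
    and "\<forall>s\<in>S - {Id_on \<Omega>}. \<forall>a\<in>\<Omega>. card (nbr a s) = k"
    and "card S > 2 * k * (k - 1) + 2"
  shows "\<forall>a\<in>\<Omega>. semiregular_off \<Omega> (alpha_ext \<Omega> S a) a"
proof -
  have sch: "scheme \<Omega> S" using assms(1) by (simp add: pseudocyclic_def)
  then have cc: "coherent_config \<Omega> S" by (simp add: scheme_def)
  \<comment> \<open>The bound exceeds 1, so a basis relation besides the diagonal exists. Its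
    nonempty neighbourhood at \<open>x\<close> forces k > 0, so that \<open>k - 1\<close> is a true
    difference.\<close>
  have "\<not> S \<subseteq> {Id_on \<Omega>}" using assms(3) card_mono[of "{Id_on \<Omega>}" S] by auto
  then obtain s where s: "s \<in> S - {Id_on \<Omega>}" by blast
  then obtain x y where xy: "(x, y) \<in> s" using coherent_configD(2)[OF cc] by fastforce
  then have x: "x \<in> \<Omega>" using s coherent_configD(3)[OF cc] by blast
  have "nbr x s \<subseteq> \<Omega>" using s coherent_configD(3)[OF cc] unfolding nbr_def by blast
  then have "finite (nbr x s)" using coherent_configD(1)[OF cc] finite_subset by blast
  moreover have "y \<in> nbr x s" using xy by (simp add: nbr_def)
  ultimately have "card (nbr x s) > 0" using card_gt_0_iff by blast
  then have "k > 0" using assms(2) s x by simp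
  then interpret equivalenced_scheme \<Omega> S k
    using sch assms(2) x by unfold_locales blast+
  show ?thesis
    using admissible_semiregular[OF assms(1,3) alpha_ext_admissible[OF cc]] by blast
qed

end
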